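(* For every (finite, simple) planar graph $G$ with no 4-cycles, there exists an ordering $\sigma$ of $V(G)$ such that each vertex $v$ is preceded in $\sigma$ by at most $\Delta(G)+72$ of its neighbors in $G^2$. In other words, $G^2$ is $(\Delta(G)+72)$-degenerate.
   Context: The square $G^2$ of a graph $G$ is the graph on $V(G)$ in which two distinct vertices are adjacent if and only if their distance in $G$ is at most $2$. $\Delta(G)$ is the maximum degree of $G$. "No 4-cycles" means $G$ contains no cycle of length $4$ as a subgraph. *)

theory Defs
  imports
    "HOL-Analysis.Analysis"
    "Graph_Theory.Pair_Digraph"
    "Graph_Theory.Digraph_Component"
    "Graph_Theory.Shortest_Path"
begin

(* Undirected graphs are symmetric digraphs: the edge uv is the pair of arcs (u,v), (v,u).
   Hence finite simple graphs are exactly the models of pair_graph, the degree of a vertex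
   is its out-degree, and a cycle of length n is traversed by n arcs. *)

definition edge_set :: "'a pair_pre_digraph \<Rightarrow> 'a set set" where
  "edge_set G = (\<lambda>(u, v). {u, v}) ` parcs G"

(* Edges are drawn as arbitrary (not necessarily polygonal) arcs; c assigns one curve to each
   undirected edge, with no orientation prescribed. *)
definition plane_drawing ::
  "'a pair_pre_digraph \<Rightarrow> ('a \<Rightarrow> complex) \<Rightarrow> ('a set \<Rightarrow> real \<Rightarrow> complex) \<Rightarrow> bool" where
  "plane_drawing G p c \<longleftrightarrow>
     inj_on p (pverts G) \<and>
     (\<forall>e \<in> edge_set G. arc (c e) \<and> {pathstart (c e), pathfinish (c e)} = p ` e \<and>
        path_image (c e) \<inter> p ` pverts G = p ` e) \<and>
     (\<forall>e \<in> edge_set G. \<forall>f \<in> edge_set G. e \<noteq> f \<longrightarrow>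
        path_image (c e) \<inter> path_image (c f) = p ` (e \<inter> f))"

definition planar :: "'a pair_pre_digraph \<Rightarrow> bool" where
  "planar G \<longleftrightarrow> (\<exists>p c. plane_drawing G p c)"

(* The distance is infinite if no walk joins the two vertices. *)
definition graph_dist :: "'a pair_pre_digraph \<Rightarrow> 'a \<Rightarrow> 'a \<Rightarrow> ereal" where
  "graph_dist G u v = wf_digraph.\<mu> (with_proj G) (\<lambda>_. 1) u v"

definition square :: "'a pair_pre_digraph \<Rightarrow> 'a pair_pre_digraph" where
  "square G = \<lparr>pverts = pverts G,
     parcs = {(u, v). u \<in> pverts G \<and> v \<in> pverts G \<and> u \<noteq> v \<and> graph_dist G u v \<le> 2}\<rparr>"

(* The inserted 0 only matters for the graph without vertices. *)
definition max_degree :: "'a pair_pre_digraph \<Rightarrow> nat" where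
  "max_degree G = Max (insert 0 (out_degree (with_proj G) ` pverts G))"

definition degenerate :: "nat \<Rightarrow> 'a pair_pre_digraph \<Rightarrow> bool" where
  "degenerate k G \<longleftrightarrow>
     (\<forall>H. pair_graph H \<and> subgraph (with_proj H) (with_proj G) \<and> pverts H \<noteq> {} \<longrightarrow>
        (\<exists>v \<in> pverts H. out_degree (with_proj H) v \<le> k))"

end

(* Contractions reduce the theorem to Mader's bound: a graph on n > 0 vertices without K5 minor has
   fewer than 3n edges. That a plane drawing has no K5 minor follows from the Jordan curve theorem,
   applied to theta graphs.

   Suppose every v in a nonempty vertex set S has at least D + 73 neighbours in S at distance at
   most 2. Call a vertex big if it has at least 18 neighbours in S; let B be the set of big vertices.
   Contract each small vertex outside S onto one of its neighbours in S. As there is no 4-cycle,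
   contracting a vertex with k > 2 neighbours in S creates at least k - 2 new edges, different ones
   for different vertices. Distribute each new edge equally among these k neighbours and every other
   edge equally between its ends: then every v in S - B with at most one big neighbour gets charge at
   least 3. A vertex of S - B with at least two big neighbours has charge
   at least 1, and contracting those vertices gives a graph on B, so there are at most 3 |B| of them.
   A big vertex has charge at least 9. Hence the contracted graph on S Un B has at least
   9 |B| + n2 + 3 n1 >= 3 (|B| + n2 + n1) edges, contradicting the bound. *)

theory Submission
  imports Defs
begin

text \<open>The square may be dense, so no edge bound with an absolute constant applies to it;
  instead, minors of \<open>G\<close> are built whose edges record pairs at distance two. Topology
  is used only once, for \<open>G\<close> itself: a minor of a graph without K5 minor has none
  either, so contracted graphs need no drawing, and Mader's bound takes the place of Euler's
  formula. The obstacle is that a single neighbour may lead to about \<open>D\<close> vertices of S.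
  One such neighbour is covered by the summand \<open>D\<close>, two are not; hence the split by the
  number of big neighbours. The threshold 18 comes from the final count: a vertex with two big
  neighbours may fall short of charge 3 by 2, and there are at most 3 |B| of these, so a big vertex
  has to supply 3 + 3 * 2 = 9, half of 18. Every neighbour that is not big then leads to at most 17
  vertices of S. If it stays in the contracted graph, it brings charge 1/2; if it is contracted, it
  brings at least 1/20 for each vertex of S it leads to. Weighing these two rates shows that 73
  vertices beyond the \<open>D\<close> suffice for charge 3.\<close>

section \<open>Separation by theta graphs\<close>

hide_const (open) Digraph_Component.connected

lemma Jordan_two_arcs:
  fixes a1 a2 :: "real \<Rightarrow> complex"
  assumes "arc a1" "arc a2" "pathstart a1 = a" "pathfinish a1 = b" "pathstart a2 = a" "pathfinish a2 = b"
    and "path_image a1 \<inter> path_image a2 = {a, b}"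
  shows "inside (path_image a1 \<union> path_image a2) \<noteq> {}" (is "?thesis1")
    and "connected (inside (path_image a1 \<union> path_image a2))" (is "?thesis2")
    and "frontier (inside (path_image a1 \<union> path_image a2)) = path_image a1 \<union> path_image a2" (is "?thesis3")
proof -
  define c where "c = a1 +++ reversepath a2"
  have c1: "simple_path c"
    unfolding c_def using assms by (intro simple_path_join_loop) (simp_all add: arc_reversepath)
  have c2: "pathfinish c = pathstart c" using assms by (simp add: c_def)
  have c3: "path_image c = path_image a1 \<union> path_image a2"
    using assms by (simp add: c_def path_image_join)
  note J = Jordan_inside_outside[OF c1 c2, unfolded c3]
  show ?thesis1 ?thesis2 ?thesis3
    by (simp_all only: J not_False_eq_True)
qed

text \<open>If \<open>y3\<close> were inside the closed curve formed by \<open>a1\<close> and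
  \<open>a2\<close>, then so would \<open>z\<close> be. The arc \<open>a3\<close> cuts that inside
  into the insides of the other two closed curves; from the part bounded by \<open>a1\<close> and
  \<open>a3\<close> the point \<open>y2\<close> on \<open>a2\<close> cannot be reached, and from the
  other part \<open>y1\<close> cannot.\<close>

lemma theta_no_inside:
  fixes a1 a2 a3 :: "real \<Rightarrow> complex"
  assumes arcs: "arc a1" "arc a2" "arc a3"
    and ends: "pathstart a1 = a" "pathfinish a1 = b" "pathstart a2 = a" "pathfinish a2 = b"
      "pathstart a3 = a" "pathfinish a3 = b"
    and int: "path_image a1 \<inter> path_image a2 = {a, b}" "path_image a1 \<inter> path_image a3 = {a, b}"
      "path_image a2 \<inter> path_image a3 = {a, b}"
    and y: "y1 \<in> path_image a1" "y2 \<in> path_image a2" "y3 \<in> path_image a3"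
    and z1: "connected_component (- (path_image a2 \<union> path_image a3)) z y1"
    and z2: "connected_component (- (path_image a1 \<union> path_image a3)) z y2"
    and z3: "connected_component (- (path_image a1 \<union> path_image a2)) z y3"
  shows "y3 \<notin> inside (path_image a1 \<union> path_image a2)"
proof
  assume inn: "y3 \<in> inside (path_image a1 \<union> path_image a2)"
  have ab: "a \<noteq> b" using arcs(1) ends arc_distinct_ends by metis
  have ne: "path_image a3 \<inter> inside (path_image a1 \<union> path_image a2) \<noteq> {}" using inn y(3) by blast
  have eq: "inside (path_image a1 \<union> path_image a3) \<union> inside (path_image a2 \<union> path_image a3) \<union>
           (path_image a3 - {a,b}) = inside (path_image a1 \<union> path_image a2)"
    by (rule split_inside_simple_closed_curve[OF arc_imp_simple_path[OF arcs(1)] ends(1,2)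
          arc_imp_simple_path[OF arcs(2)] ends(3,4) arc_imp_simple_path[OF arcs(3)] ends(5,6) ab int ne])
  have "z \<in> inside (path_image a1 \<union> path_image a2)"
    using inn z3 inside_same_component connected_component_sym by blast
  moreover have "z \<notin> path_image a3" using z1 connected_component_in by blast
  ultimately consider "z \<in> inside (path_image a1 \<union> path_image a3)" | "z \<in> inside (path_image a2 \<union> path_image a3)"
    using eq by blast
  then show False
  proof cases
    case 1
    then have "y2 \<in> inside (path_image a1 \<union> path_image a3)" using z2 inside_same_component by blast
    then show False using eq y(2) inside_no_overlap by blast
  next
    case 2
    then have "y1 \<in> inside (path_image a2 \<union> path_image a3)" using z1 inside_same_component by blast
    then show False using eq y(1) inside_no_overlap by blast
  qed
qed

text \<open>The first inside is connected and avoids \<open>a1\<close> and \<open>a3\<close>, so if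
  it met the second it would lie within it. But \<open>y2\<close> is a frontier point of the first
  inside and lies in the open outside of the second curve, so the first inside has points there as
  well.\<close>

lemma theta_not_nested:
  fixes a1 a2 a3 :: "real \<Rightarrow> complex"
  assumes arcs: "arc a1" "arc a2" "arc a3"
    and ends: "pathstart a1 = a" "pathfinish a1 = b" "pathstart a2 = a" "pathfinish a2 = b"
      "pathstart a3 = a" "pathfinish a3 = b"
    and int: "path_image a1 \<inter> path_image a2 = {a, b}"
    and y: "y2 \<in> path_image a2" "y2 \<notin> path_image a1 \<union> path_image a3"
      "y2 \<notin> inside (path_image a1 \<union> path_image a3)"
    and disj: "path_image a3 \<inter> inside (path_image a1 \<union> path_image a2) = {}"
  shows "inside (path_image a1 \<union> path_image a2) \<inter> inside (path_image a1 \<union> path_image a3) = {}"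
proof (rule ccontr)
  let ?I = "inside (path_image a1 \<union> path_image a2)" and ?J = "inside (path_image a1 \<union> path_image a3)"
  assume ne: "?I \<inter> ?J \<noteq> {}"
  note J = Jordan_two_arcs[OF arcs(1,2) ends(1-4) int]
  obtain p where p: "p \<in> ?I" "p \<in> ?J" using ne by auto
  have "?I \<inter> (path_image a1 \<union> path_image a3) = {}"
    using disj inside_no_overlap[of "path_image a1 \<union> path_image a2"] by blast
  then have "?I \<subseteq> - (path_image a1 \<union> path_image a3)" by blast
  have sub: "?I \<subseteq> ?J"
  proof
    fix w assume "w \<in> ?I"
    then have "connected_component (- (path_image a1 \<union> path_image a3)) p w"
      using p(1) J(2) \<open>?I \<subseteq> - (path_image a1 \<union> path_image a3)\<close>
      unfolding connected_component_def by (intro exI[of _ ?I]) simp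
    then show "w \<in> ?J" using p(2) by (rule inside_same_component)
  qed
  have "y2 \<in> frontier ?I" using J(3) y(1) by simp
  then have "y2 \<in> closure ?I" by (simp add: frontier_def)
  moreover have "closed (path_image a1 \<union> path_image a3)" using arcs by (simp add: closed_arc_image closed_Un)
  then have "open (outside (path_image a1 \<union> path_image a3))" by (rule open_outside)
  moreover have "y2 \<in> outside (path_image a1 \<union> path_image a3)"
    using y(2,3) inside_Un_outside by blast
  ultimately obtain w where "w \<in> ?I" "w \<in> outside (path_image a1 \<union> path_image a3)"
    using open_Int_closure_eq_empty[of "outside (path_image a1 \<union> path_image a3)" ?I] by blast
  then show False using sub inside_Int_outside by blast
qed

text \<open>In essence the non-planarity of $K_{3,3}$.\<close>

lemma theta_separation:
  fixes a1 a2 a3 :: "real \<Rightarrow> complex"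
  assumes arcs: "arc a1" "arc a2" "arc a3"
    and ends: "pathstart a1 = a" "pathfinish a1 = b" "pathstart a2 = a" "pathfinish a2 = b"
      "pathstart a3 = a" "pathfinish a3 = b"
    and int: "path_image a1 \<inter> path_image a2 = {a, b}" "path_image a1 \<inter> path_image a3 = {a, b}"
      "path_image a2 \<inter> path_image a3 = {a, b}"
    and y: "y1 \<in> path_image a1" "y2 \<in> path_image a2" "y3 \<in> path_image a3"
    and z1: "connected_component (- (path_image a2 \<union> path_image a3)) z y1"
    and z2: "connected_component (- (path_image a1 \<union> path_image a3)) z y2"
    and z3: "connected_component (- (path_image a1 \<union> path_image a2)) z y3"
  shows False
proof -
  let ?P1 = "path_image a1" and ?P2 = "path_image a2" and ?P3 = "path_image a3"
  have comm: "?P2 \<union> ?P1 = ?P1 \<union> ?P2" "?P3 \<union> ?P1 = ?P1 \<union> ?P3" "?P3 \<union> ?P2 = ?P2 \<union> ?P3"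
    "?P2 \<inter> ?P1 = ?P1 \<inter> ?P2" "?P3 \<inter> ?P1 = ?P1 \<inter> ?P3" "?P3 \<inter> ?P2 = ?P2 \<inter> ?P3" by auto
  have o3: "y3 \<notin> inside (?P1 \<union> ?P2)"
    using theta_no_inside[of a1 a2 a3 a b y1 y2 y3 z] assms by blast
  have o2: "y2 \<notin> inside (?P1 \<union> ?P3)"
    using theta_no_inside[of a1 a3 a2 a b y1 y3 y2 z] assms unfolding comm by blast
  have o1: "y1 \<notin> inside (?P2 \<union> ?P3)"
    using theta_no_inside[of a2 a3 a1 a b y2 y3 y1 z] assms unfolding comm by blast
  have n1: "y1 \<notin> ?P2 \<union> ?P3" and n2: "y2 \<notin> ?P1 \<union> ?P3" and n3: "y3 \<notin> ?P1 \<union> ?P2"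
    using z1 z2 z3 connected_component_in by blast+
  let ?I = "inside (?P1 \<union> ?P2)"
  \<comment> \<open>Without its ends \<open>a3\<close> is connected and avoids the other two arcs,
    so one of its points inside would bring \<open>y3\<close> inside too.\<close>
  have disj: "?P3 \<inter> ?I = {}"
  proof (rule ccontr)
    assume "?P3 \<inter> ?I \<noteq> {}"
    then obtain w where w: "w \<in> ?P3" "w \<in> ?I" by auto
    have cn: "connected (?P3 - {a, b})"
      using connected_simple_path_endless[OF arc_imp_simple_path[OF arcs(3)]] ends by simp
    have "a \<in> ?P1" "b \<in> ?P1" using ends(1,2) by (metis pathstart_in_path_image, metis pathfinish_in_path_image)
    then have "a \<noteq> y3" "b \<noteq> y3" "w \<noteq> a" "w \<noteq> b"
      using n3 w inside_no_overlap[of "?P1 \<union> ?P2"] by blast+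
    moreover have "?P3 - {a, b} \<subseteq> - (?P1 \<union> ?P2)" using int by blast
    ultimately have "connected_component (- (?P1 \<union> ?P2)) w y3"
      using cn w(1) y(3) unfolding connected_component_def by (intro exI[of _ "?P3 - {a, b}"]) auto
    then show False using o3 w(2) inside_same_component by blast
  qed
  \<comment> \<open>A point \<open>p\<close> inside the curve of \<open>a1\<close> and
    \<open>a2\<close> turns out to lie outside both other curves. These two share exactly the
    connected set \<open>path_image a3\<close>, so Janiszewski's theorem joins \<open>p\<close> to a
    far point \<open>q\<close> off all three arcs, which is impossible from the inside.\<close>
  obtain p where p: "p \<in> ?I" using Jordan_two_arcs(1)[OF arcs(1,2) ends(1-4) int(1)] by blast
  have "p \<notin> inside (?P1 \<union> ?P3)"
    using theta_not_nested[of a1 a2 a3 a b y2] arcs ends int y n2 o2 disj p by blast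
  moreover have "p \<notin> inside (?P2 \<union> ?P3)"
    using theta_not_nested[of a2 a1 a3 a b y1] arcs ends int y n1 o1 disj p unfolding comm by blast
  moreover have np: "p \<notin> ?P1 \<union> ?P2 \<union> ?P3" using p disj inside_no_overlap by blast
  ultimately have po: "p \<in> outside (?P1 \<union> ?P3)" "p \<in> outside (?P2 \<union> ?P3)"
    using inside_Un_outside by blast+
  have cp: "compact ?P1" "compact ?P2" "compact ?P3" using arcs compact_arc_image by auto
  then have "bounded (?P1 \<union> ?P2 \<union> ?P3)" by (simp add: compact_imp_bounded)
  then obtain r where r: "?P1 \<union> ?P2 \<union> ?P3 \<subseteq> ball 0 r" using bounded_subset_ballD by blast
  have "\<exists>q::complex. q \<in> - ball 0 r"
  proof -
    have "norm (complex_of_real (\<bar>r\<bar> + 1)) = \<bar>r\<bar> + 1" by (simp only: norm_of_real)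
    then have "complex_of_real (\<bar>r\<bar> + 1) \<notin> ball 0 r" by (simp only: mem_ball_0)
    then show ?thesis by blast
  qed
  then obtain q :: complex where q: "q \<in> - ball 0 r" by blast
  have far: "q \<in> outside S" if "S \<subseteq> ball 0 r" for S
    using outside_subset_convex[OF convex_ball that] q by (rule subsetD)
  have qo: "q \<in> outside (?P1 \<union> ?P3)" "q \<in> outside (?P2 \<union> ?P3)" "q \<in> outside (?P1 \<union> ?P2)"
    by (rule far, use r in simp)+
  have cc: "connected_component (- S) p q" if "p \<in> outside S" "q \<in> outside S" "bounded S" for S :: "complex set"
    unfolding connected_component_def
    using that connected_outside[of S] outside_no_overlap[of S] by (intro exI[of _ "outside S"]) (simp flip: disjoint_eq_subset_Compl)
  have "connected_component (- ((?P1 \<union> ?P3) \<union> (?P2 \<union> ?P3))) p q"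
  proof (rule Janiszewski)
    show "compact (?P1 \<union> ?P3)" "closed (?P2 \<union> ?P3)" using cp by (simp_all add: compact_imp_closed compact_Un closed_Un)
    have "a \<in> ?P3" "b \<in> ?P3" using ends(5,6) by (metis pathstart_in_path_image, metis pathfinish_in_path_image)
    then have "(?P1 \<union> ?P3) \<inter> (?P2 \<union> ?P3) = ?P3" using int by auto
    then show "connected ((?P1 \<union> ?P3) \<inter> (?P2 \<union> ?P3))" using arcs(3) connected_arc_image by simp
    show "connected_component (- (?P1 \<union> ?P3)) p q" "connected_component (- (?P2 \<union> ?P3)) p q"
      by (rule cc[OF po(1) qo(1)] cc[OF po(2) qo(2)], simp add: cp compact_imp_bounded)+
  qed
  then have "connected_component (- (?P1 \<union> ?P2)) p q"
    by (rule connected_component_of_subset) auto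
  then have "q \<in> ?I" using p inside_same_component by blast
  then show False using qo(3) inside_Int_outside by blast
qed

section \<open>Arcs and connected sets inside path-connected sets with accessible points\<close>

lemma path_connected_insert2:
  assumes "path_connected (insert p S)" "path_connected (insert q S)" "S \<noteq> {}"
  shows "path_connected (insert p (insert q S))"
proof -
  have "insert p (insert q S) = insert p S \<union> insert q S" by auto
  moreover have "path_connected (insert p S \<union> insert q S)"
    by (rule path_connected_Un) (use assms in auto)
  ultimately show ?thesis by simp
qed

text \<open>The arc is cut at the first parameter that it spends in \<open>A\<close>; compactness
  provides it. In \<open>tripod\<close> this makes the third leg meet the other two only at its
  end.\<close>

lemma arc_until_closed:
  fixes g :: "real \<Rightarrow> 'a::euclidean_space"
  assumes "arc g" "closed A" "pathstart g \<notin> A" "pathfinish g \<in> A"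
  obtains h where "arc h" "pathstart h = pathstart g" "path_image h \<subseteq> path_image g"
    "path_image h \<inter> A = {pathfinish h}"
proof -
  define T where "T = {t \<in> {0..1}. g t \<in> A}"
  have cg: "continuous_on {0..1} g" using assms(1) by (simp add: arc_def path_def)
  have "T = {0..1} \<inter> g -` A" by (auto simp: T_def)
  then have "closed T" using continuous_on_closed_vimage[of "{0..1}" g] cg assms(2)
    by (metis Int_commute closed_atLeastAtMost)
  moreover have "bounded T" by (rule bounded_subset[of "{0..1}"]) (auto simp: T_def)
  ultimately have "compact T" by (simp add: compact_eq_bounded_closed)
  moreover have "1 \<in> T" using assms(4) by (simp add: T_def pathfinish_def)
  ultimately obtain t where t: "t \<in> T" "\<And>s. s \<in> T \<Longrightarrow> t \<le> s" using compact_attains_inf[of T] by auto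
  have t0: "t \<noteq> 0" using t(1) assms(3) by (auto simp: T_def pathstart_def)
  have t01: "t \<in> {0..1}" using t by (simp add: T_def)
  have img: "path_image (subpath 0 t g) = g ` {0..t}" using t01 by (simp add: path_image_subpath)
  show thesis
  proof
    show "arc (subpath 0 t g)" using assms(1) t0 t01 by (intro arc_subpath_arc) auto
    show "pathstart (subpath 0 t g) = pathstart g" by (simp add: pathstart_def subpath_def)
    show "path_image (subpath 0 t g) \<subseteq> path_image g" using img t01 by (auto simp: path_image_def)
    show "path_image (subpath 0 t g) \<inter> A = {pathfinish (subpath 0 t g)}"
    proof -
      have "s = t" if "s \<in> {0..t}" "g s \<in> A" for s
        using t(2)[of s] that t01 by (auto simp: T_def)
      then have "g ` {0..t} \<inter> A \<subseteq> {g t}" by blast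
      then show ?thesis unfolding img using t t01 by (auto simp: T_def)
    qed
  qed
qed

lemma arc_split_at:
  fixes g :: "real \<Rightarrow> 'a::euclidean_space"
  assumes "arc g" "v \<in> path_image g" "v \<noteq> pathstart g" "v \<noteq> pathfinish g"
  obtains g1 g2 where "arc g1" "arc g2" "pathstart g1 = v" "pathfinish g1 = pathstart g"
    "pathstart g2 = v" "pathfinish g2 = pathfinish g"
    "path_image g1 \<union> path_image g2 = path_image g" "path_image g1 \<inter> path_image g2 = {v}"
proof -
  obtain t where t: "t \<in> {0..1}" "v = g t" using assms(2) by (auto simp: path_image_def)
  have t01: "t \<noteq> 0" "t \<noteq> 1" using assms(3,4) t by (auto simp: pathstart_def pathfinish_def)
  have inj: "inj_on g {0..1}" using assms(1) by (simp add: arc_def)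
  have i1: "path_image (subpath t 0 g) = g ` {0..t}" using t t01 by (simp add: path_image_subpath)
  have i2: "path_image (subpath t 1 g) = g ` {t..1}" using t by (simp add: path_image_subpath)
  show thesis
  proof
    show "arc (subpath t 0 g)" "arc (subpath t 1 g)" using assms(1) t t01 by (auto intro!: arc_subpath_arc)
    show "path_image (subpath t 0 g) \<union> path_image (subpath t 1 g) = path_image g"
      unfolding i1 i2 image_Un[symmetric] using t by (simp add: path_image_def ivl_disj_un_two_touch)
    have "g ` {0..t} \<inter> g ` {t..1} = g ` ({0..t} \<inter> {t..1})"
      by (rule inj_on_image_Int[OF inj, symmetric]) (use t in auto)
    also have "{0..t} \<inter> {t..1} = {t}" using t by auto
    finally show "path_image (subpath t 0 g) \<inter> path_image (subpath t 1 g) = {v}"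
      unfolding i1 i2 using t by simp
  qed (use t in \<open>auto simp: pathstart_def pathfinish_def subpath_def\<close>)
qed

text \<open>The centre \<open>v\<close> is the point where an arc starting in \<open>c\<close> first
  hits an arc from \<open>a\<close> to \<open>b\<close>; it splits the latter into two legs. The
  three tips lie outside \<open>M\<close> because they will be the points where \<open>M\<close>
  touches its neighbours.\<close>

lemma tripod:
  fixes M :: "'a::euclidean_space set"
  assumes M: "M \<noteq> {}" "path_connected (insert a M)" "path_connected (insert b M)" "path_connected (insert c M)"
    and nin: "a \<notin> M" "b \<notin> M" "c \<notin> M" and ne: "a \<noteq> b" "a \<noteq> c" "b \<noteq> c"
  obtains v \<alpha> \<beta> \<gamma> where "v \<in> M" "arc \<alpha>" "arc \<beta>" "arc \<gamma>"
    "pathstart \<alpha> = v" "pathstart \<beta> = v" "pathstart \<gamma> = v"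
    "pathfinish \<alpha> = a" "pathfinish \<beta> = b" "pathfinish \<gamma> = c"
    "path_image \<alpha> \<subseteq> insert a M" "path_image \<beta> \<subseteq> insert b M" "path_image \<gamma> \<subseteq> insert c M"
    "path_image \<alpha> \<inter> path_image \<beta> = {v}" "path_image \<alpha> \<inter> path_image \<gamma> = {v}"
    "path_image \<beta> \<inter> path_image \<gamma> = {v}"
proof -
  have "path_connected (insert a (insert b M))" using M by (intro path_connected_insert2)
  then obtain A where A: "arc A" "path_image A \<subseteq> insert a (insert b M)" "pathstart A = a" "pathfinish A = b"
    using ne unfolding path_connected_arcwise by (metis insertI1 insertI2)
  \<comment> \<open>The third leg needs a target in \<open>M\<close>, since \<open>a\<close> and
    \<open>b\<close> do not belong to \<open>insert c M\<close>. The midpoint of \<open>A\<close>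
    serves, being neither of its ends.\<close>
  have "\<exists>w. w \<in> path_image A \<and> w \<in> M"
  proof -
    have "A (1/2) \<in> path_image A" by (auto simp: path_image_def)
    moreover have "inj_on A {0..1}" using A(1) by (simp add: arc_def)
    then have "A (1/2) \<noteq> A 0" "A (1/2) \<noteq> A 1" by (simp_all add: inj_on_eq_iff)
    ultimately show ?thesis using A by (auto simp: pathstart_def pathfinish_def)
  qed
  then obtain w where w: "w \<in> path_image A" "w \<in> M" by auto
  then obtain g where g: "arc g" "path_image g \<subseteq> insert c M" "pathstart g = c" "pathfinish g = w"
    using M(4) nin unfolding path_connected_arcwise by (metis insertI1 insertI2)
  have cA: "c \<notin> path_image A" using A ne nin by auto
  obtain h where h: "arc h" "pathstart h = c" "path_image h \<subseteq> path_image g" "path_image h \<inter> path_image A = {pathfinish h}"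
    by (rule arc_until_closed[OF g(1) closed_arc_image[OF A(1)]]) (use cA g w in auto)
  define v where "v = pathfinish h"
  have vh: "v \<in> path_image h" "v \<in> path_image A" using h(4) by (auto simp: v_def)
  have vM: "v \<in> M" using vh h(3) g(2) cA by auto
  obtain \<alpha> \<beta> where ab: "arc \<alpha>" "arc \<beta>" "pathstart \<alpha> = v" "pathfinish \<alpha> = a" "pathstart \<beta> = v" "pathfinish \<beta> = b"
    "path_image \<alpha> \<union> path_image \<beta> = path_image A" "path_image \<alpha> \<inter> path_image \<beta> = {v}"
    using arc_split_at[OF A(1) vh(2)] A(3,4) vM nin by metis
  have aa: "a \<in> path_image \<alpha>" and bb: "b \<in> path_image \<beta>"
    using ab pathfinish_in_path_image by metis+
  have "a \<notin> path_image \<beta>" "b \<notin> path_image \<alpha>" using aa bb ab(8) vM nin by auto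
  moreover have "v \<in> path_image \<alpha>" "v \<in> path_image \<beta>" using ab(8) by auto
  ultimately have "path_image \<alpha> \<subseteq> insert a M" "path_image \<beta> \<subseteq> insert b M" "path_image h \<subseteq> insert c M"
    "path_image \<alpha> \<inter> path_image h = {v}" "path_image \<beta> \<inter> path_image h = {v}"
    using A(2) ab(7) h(3,4) g(2) vh by (auto simp: v_def[symmetric])
  then show thesis
    using that[of v \<alpha> \<beta> "reversepath h"] vM ab h(1,2) v_def by (simp add: arc_reversepath)
qed

text \<open>Provides the connections from \<open>N 4\<close> to the theta graph: from
  \<open>T\<close> through a common touching point \<open>p\<close> into \<open>S\<close>, and on to
  a point \<open>q\<close> where \<open>S\<close> touches a third set.\<close>

lemma path_connected_link:
  assumes "path_connected (insert p S)" "path_connected (insert q S)" "path_connected (insert p T)" "S \<noteq> {}"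
  shows "path_connected (insert p T \<union> insert q S)"
proof -
  have "insert p T \<union> insert q S = insert p T \<union> insert p (insert q S)" by auto
  moreover have "path_connected (insert p T \<union> insert p (insert q S))"
    using assms by (intro path_connected_Un path_connected_insert2) auto
  ultimately show ?thesis by simp
qed

text \<open>\<open>P\<close> becomes part of a theta graph, while \<open>K\<close> also reaches out
  to \<open>c\<close>. Two such sets with the same \<open>c\<close> have a connected union, as
  Janiszewski's theorem will require.\<close>

lemma arc_with_whisker:
  fixes M :: "'a::euclidean_space set"
  assumes "M \<noteq> {}" "path_connected (insert a M)" "path_connected (insert b M)" "path_connected (insert c M)" "a \<noteq> b"
  obtains P K where "arc P" "pathstart P = a" "pathfinish P = b" "path_image P \<subseteq> insert a (insert b M)"
    "path_image P \<subseteq> K" "compact K" "connected K" "c \<in> K" "K \<subseteq> insert a (insert b (insert c M))"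
proof -
  have "path_connected (insert a (insert b M))" "path_connected (insert a (insert c M))"
    using assms by (auto intro: path_connected_insert2)
  note pc = this
  obtain P where P: "arc P" "path_image P \<subseteq> insert a (insert b M)" "pathstart P = a" "pathfinish P = b"
    using iffD1[OF path_connected_arcwise pc(1), rule_format, of a b] assms(5) by auto
  obtain g where g: "path g" "path_image g \<subseteq> insert a (insert c M)" "pathstart g = a" "pathfinish g = c"
    using iffD1[OF path_connected_def pc(2), rule_format, of a c] by auto
  have aP: "a \<in> path_image P" "a \<in> path_image g" "c \<in> path_image g"
    using P(3) g(3,4) pathstart_in_path_image pathfinish_in_path_image by metis+
  show thesis
  proof (rule that[of P "path_image P \<union> path_image g"])
    show "connected (path_image P \<union> path_image g)"
      using P(1) g(1) aP by (intro connected_Un connected_arc_image connected_path_image) auto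
    show "compact (path_image P \<union> path_image g)"
      using P(1) g(1) by (simp add: compact_Un compact_arc_image compact_path_image)
  qed (use P g aP in auto)
qed

text \<open>Non-planarity of $K_5$. The arcs of the theta graph run from a point of \<open>N 0\<close> to a point of \<open>N 1\<close>,
  directly, through \<open>N 2\<close> and through \<open>N 3\<close>, and \<open>N 4\<close> is adherent to each of them; for the direct arc
  this rests on Janiszewski's theorem.\<close>

lemma no_five_mutually_touching:
  fixes N :: "nat \<Rightarrow> complex set" and m :: "nat \<Rightarrow> nat \<Rightarrow> complex"
  assumes ne: "\<And>i. i < 5 \<Longrightarrow> N i \<noteq> {}"
    and disj: "\<And>i j. i < 5 \<Longrightarrow> j < 5 \<Longrightarrow> i \<noteq> j \<Longrightarrow> N i \<inter> N j = {}"
    and pc: "\<And>i j. i < 5 \<Longrightarrow> j < 5 \<Longrightarrow> i \<noteq> j \<Longrightarrow> path_connected (insert (m i j) (N i))"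
    and sym: "\<And>i j. m i j = m j i"
    and inj: "\<And>i j k l. i < 5 \<Longrightarrow> j < 5 \<Longrightarrow> i \<noteq> j \<Longrightarrow> k < 5 \<Longrightarrow> l < 5 \<Longrightarrow> k \<noteq> l \<Longrightarrow>
      m i j = m k l \<Longrightarrow> {i, j} = {k, l}"
    and mN: "\<And>i j k. i < 5 \<Longrightarrow> j < 5 \<Longrightarrow> i \<noteq> j \<Longrightarrow> k < 5 \<Longrightarrow> m i j \<notin> N k"
  shows False
proof -
  obtain N0 N1 N2 N3 N4 where N: "N0 = N 0" "N1 = N 1" "N2 = N 2" "N3 = N 3" "N4 = N 4" by blast
  obtain m01 m02 m03 m04 m12 m13 m14 m23 m24 m34 where
    m: "m01 = m 0 1" "m02 = m 0 2" "m03 = m 0 3" "m04 = m 0 4" "m12 = m 1 2" "m13 = m 1 3" "m14 = m 1 4"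
      "m23 = m 2 3" "m24 = m 2 4" "m34 = m 3 4" by blast
  have m': "m 1 0 = m01" "m 2 0 = m02" "m 3 0 = m03" "m 4 0 = m04" "m 2 1 = m12" "m 3 1 = m13" "m 4 1 = m14"
      "m 3 2 = m23" "m 4 2 = m24" "m 4 3 = m34" unfolding m by (rule sym)+
  have neN: "N0 \<noteq> {}" "N1 \<noteq> {}" "N2 \<noteq> {}" "N3 \<noteq> {}" "N4 \<noteq> {}" unfolding N by (rule ne; simp)+
  have pcs: "path_connected (insert m01 N0)" "path_connected (insert m02 N0)" "path_connected (insert m03 N0)" "path_connected (insert m04 N0)"
     "path_connected (insert m01 N1)" "path_connected (insert m12 N1)" "path_connected (insert m13 N1)" "path_connected (insert m14 N1)"
     "path_connected (insert m02 N2)" "path_connected (insert m12 N2)" "path_connected (insert m23 N2)" "path_connected (insert m24 N2)"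
     "path_connected (insert m03 N3)" "path_connected (insert m13 N3)" "path_connected (insert m23 N3)" "path_connected (insert m34 N3)"
     "path_connected (insert m04 N4)" "path_connected (insert m14 N4)" "path_connected (insert m24 N4)" "path_connected (insert m34 N4)"
    using pc[of 0 1] pc[of 0 2] pc[of 0 3] pc[of 0 4] pc[of 1 0] pc[of 1 2] pc[of 1 3] pc[of 1 4]
      pc[of 2 0] pc[of 2 1] pc[of 2 3] pc[of 2 4] pc[of 3 0] pc[of 3 1] pc[of 3 2] pc[of 3 4]
      pc[of 4 0] pc[of 4 1] pc[of 4 2] pc[of 4 3]
    unfolding m' m[symmetric] N[symmetric] by simp_all
  have dN: "N0 \<inter> N1 = {}" "N0 \<inter> N2 = {}" "N0 \<inter> N3 = {}" "N0 \<inter> N4 = {}" "N1 \<inter> N2 = {}" "N1 \<inter> N3 = {}" "N1 \<inter> N4 = {}"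
     "N2 \<inter> N3 = {}" "N2 \<inter> N4 = {}" "N3 \<inter> N4 = {}"
    unfolding N by (rule disj; simp)+
  have mm: "distinct [m01, m02, m03, m04, m12, m13, m14, m23, m24, m34]"
  proof -
    have *: "m i j \<noteq> m k l" if "i < 5" "j < 5" "i \<noteq> j" "k < 5" "l < 5" "k \<noteq> l" "{i, j} \<noteq> {k, l}" for i j k l
      using inj[OF that(1-6)] that(7) by iprover
    show ?thesis unfolding m by (simp, intro conjI; rule *; simp add: doubleton_eq_iff)
  qed
  have nN: "x \<notin> N0 \<union> N1 \<union> N2 \<union> N3 \<union> N4" if "x \<in> {m01, m02, m03, m04, m12, m13, m14, m23, m24, m34}" for x
    using that unfolding N m by (simp only: Un_iff insert_iff empty_iff de_Morgan_disj, elim disjE FalseE; simp add: mN)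
  have nN': "{m01, m02, m03, m04, m12, m13, m14, m23, m24, m34} \<inter> (N0 \<union> N1 \<union> N2 \<union> N3 \<union> N4) = {}"
    using nN by blast
  have dN': "N1 \<inter> N0 = {}" "N2 \<inter> N0 = {}" "N3 \<inter> N0 = {}" "N4 \<inter> N0 = {}" "N2 \<inter> N1 = {}" "N3 \<inter> N1 = {}"
     "N4 \<inter> N1 = {}" "N3 \<inter> N2 = {}" "N4 \<inter> N2 = {}" "N4 \<inter> N3 = {}"
    using dN by (simp_all only: Int_commute)
  \<comment> \<open>The reversed list supplies the inequalities in the other orientation, so that
    with \<open>sep\<close> the simplifier can evaluate all intersections of these sets.\<close>
  have "distinct (rev [m01, m02, m03, m04, m12, m13, m14, m23, m24, m34])" using mm by (simp only: distinct_rev)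
  note sep = mm[simplified] this[simplified] nN'[simplified] dN dN' Int_Un_distrib Int_Un_distrib2 Int_insert_left Int_insert_right
  obtain u \<alpha>1 \<alpha>2 \<alpha>3 where u: "u \<in> N0" and \<alpha>: "arc \<alpha>1" "arc \<alpha>2" "arc \<alpha>3"
    "pathstart \<alpha>1 = u" "pathstart \<alpha>2 = u" "pathstart \<alpha>3 = u"
    "pathfinish \<alpha>1 = m01" "pathfinish \<alpha>2 = m02" "pathfinish \<alpha>3 = m03"
    and \<alpha>s: "path_image \<alpha>1 \<subseteq> insert m01 N0" "path_image \<alpha>2 \<subseteq> insert m02 N0" "path_image \<alpha>3 \<subseteq> insert m03 N0"
    and \<alpha>i: "path_image \<alpha>1 \<inter> path_image \<alpha>2 = {u}" "path_image \<alpha>1 \<inter> path_image \<alpha>3 = {u}"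
    "path_image \<alpha>2 \<inter> path_image \<alpha>3 = {u}"
    by (rule tripod[OF neN(1) pcs(1-3)]) (simp_all add: sep)
  obtain v \<beta>1 \<beta>2 \<beta>3 where v: "v \<in> N1" and \<beta>: "arc \<beta>1" "arc \<beta>2" "arc \<beta>3"
    "pathstart \<beta>1 = v" "pathstart \<beta>2 = v" "pathstart \<beta>3 = v"
    "pathfinish \<beta>1 = m01" "pathfinish \<beta>2 = m12" "pathfinish \<beta>3 = m13"
    and \<beta>s: "path_image \<beta>1 \<subseteq> insert m01 N1" "path_image \<beta>2 \<subseteq> insert m12 N1" "path_image \<beta>3 \<subseteq> insert m13 N1"
    and \<beta>i: "path_image \<beta>1 \<inter> path_image \<beta>2 = {v}" "path_image \<beta>1 \<inter> path_image \<beta>3 = {v}"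
    "path_image \<beta>2 \<inter> path_image \<beta>3 = {v}"
    by (rule tripod[OF neN(2) pcs(5-7)]) (simp_all add: sep)
  obtain P2 K2 where P2: "arc P2" "pathstart P2 = m02" "pathfinish P2 = m12"
    and P2s: "path_image P2 \<subseteq> insert m02 (insert m12 N2)" and K2: "path_image P2 \<subseteq> K2" "compact K2" "connected K2" "m23 \<in> K2"
    and K2s: "K2 \<subseteq> insert m02 (insert m12 (insert m23 N2))"
    by (rule arc_with_whisker[OF neN(3) pcs(9-11)]) (simp_all add: sep)
  obtain P3 K3 where P3: "arc P3" "pathstart P3 = m03" "pathfinish P3 = m13"
    and P3s: "path_image P3 \<subseteq> insert m03 (insert m13 N3)" and K3: "path_image P3 \<subseteq> K3" "compact K3" "connected K3" "m23 \<in> K3"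
    and K3s: "K3 \<subseteq> insert m03 (insert m13 (insert m23 N3))"
    by (rule arc_with_whisker[OF neN(4) pcs(13-15)]) (simp_all add: sep)
  have ends: "m01 \<in> path_image \<alpha>1" "m02 \<in> path_image \<alpha>2" "m03 \<in> path_image \<alpha>3"
      "m01 \<in> path_image \<beta>1" "m12 \<in> path_image \<beta>2" "m13 \<in> path_image \<beta>3"
      "m02 \<in> path_image P2" "m12 \<in> path_image P2" "m03 \<in> path_image P3" "m13 \<in> path_image P3"
    using \<alpha> \<beta> P2 P3 pathstart_in_path_image[of P2] pathstart_in_path_image[of P3]
      pathfinish_in_path_image[of P2] pathfinish_in_path_image[of P3]
      pathfinish_in_path_image[of \<alpha>1] pathfinish_in_path_image[of \<alpha>2] pathfinish_in_path_image[of \<alpha>3]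
      pathfinish_in_path_image[of \<beta>1] pathfinish_in_path_image[of \<beta>2] pathfinish_in_path_image[of \<beta>3]
    by simp_all
  define a1 where "a1 = \<alpha>1 +++ reversepath \<beta>1"
  define a2 where "a2 = \<alpha>2 +++ (P2 +++ reversepath \<beta>2)"
  define a3 where "a3 = \<alpha>3 +++ (P3 +++ reversepath \<beta>3)"
  have i1: "path_image a1 = path_image \<alpha>1 \<union> path_image \<beta>1"
    and i2: "path_image a2 = path_image \<alpha>2 \<union> path_image P2 \<union> path_image \<beta>2"
    and i3: "path_image a3 = path_image \<alpha>3 \<union> path_image P3 \<union> path_image \<beta>3"
    by (simp_all add: a1_def a2_def a3_def path_image_join \<alpha> \<beta> P2 P3 Un_assoc)
  obtain z where z: "z \<in> N4" using neN by auto
  have reach: "connected_component (- S) z y"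
    if "path_connected W" "z \<in> W" "y \<in> W" "W \<inter> S = {}" for S W y
    unfolding connected_component_def
    using that by (intro exI[of _ W]) (simp add: path_connected_imp_connected disjoint_eq_subset_Compl)
  have z3: "connected_component (- (path_image a1 \<union> path_image a2)) z m03"
  proof (rule reach)
    show "path_connected (insert m34 N4 \<union> insert m03 N3)" by (rule path_connected_link; simp add: pcs neN)
    show "(insert m34 N4 \<union> insert m03 N3) \<inter> (path_image a1 \<union> path_image a2) = {}"
    proof -
      have "path_image a1 \<union> path_image a2 \<subseteq> N0 \<union> N1 \<union> N2 \<union> {m01, m02, m12}"
        unfolding i1 i2 using \<alpha>s \<beta>s P2s by blast
      moreover have "(insert m34 N4 \<union> insert m03 N3) \<inter> (N0 \<union> N1 \<union> N2 \<union> {m01, m02, m12}) = {}"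
        by (simp_all add: sep)
      ultimately show ?thesis by blast
    qed
  qed (simp_all add: z)
  have z2: "connected_component (- (path_image a1 \<union> path_image a3)) z m02"
  proof (rule reach)
    show "path_connected (insert m24 N4 \<union> insert m02 N2)" by (rule path_connected_link; simp add: pcs neN)
    show "(insert m24 N4 \<union> insert m02 N2) \<inter> (path_image a1 \<union> path_image a3) = {}"
    proof -
      have "path_image a1 \<union> path_image a3 \<subseteq> N0 \<union> N1 \<union> N3 \<union> {m01, m03, m13}"
        unfolding i1 i3 using \<alpha>s \<beta>s P3s by blast
      moreover have "(insert m24 N4 \<union> insert m02 N2) \<inter> (N0 \<union> N1 \<union> N3 \<union> {m01, m03, m13}) = {}"
        by (simp_all add: sep)
      ultimately show ?thesis by blast
    qed
  qed (simp_all add: z)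
  \<comment> \<open>The direct arc \<open>a1\<close> has no set of its own next to
    \<open>N4\<close>. The point \<open>m01\<close> is reached through \<open>N0\<close>, avoiding
    the \<beta> legs and both \<open>K\<close> sets, and through \<open>N1\<close>, avoiding the
    \<alpha> legs and both \<open>K\<close> sets. The two obstacles meet in
    \<open>K2 \<union> K3\<close>, which is connected because both parts contain
    \<open>m23\<close>.\<close>
  have z1: "connected_component (- (path_image a2 \<union> path_image a3)) z m01"
  proof -
    let ?B = "path_image \<beta>2 \<union> path_image \<beta>3" and ?A = "path_image \<alpha>2 \<union> path_image \<alpha>3" and ?K = "K2 \<union> K3"
    have "connected_component (- ((?B \<union> ?K) \<union> (?A \<union> ?K))) z m01"
    proof (rule Janiszewski)
      show "compact (?B \<union> ?K)" using \<beta> K2 K3 by (simp add: compact_arc_image compact_Un)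
      have "compact (?A \<union> ?K)" using \<alpha> K2 K3 by (simp add: compact_arc_image compact_Un)
      then show "closed (?A \<union> ?K)" by (rule compact_imp_closed)
      have sA: "?A \<subseteq> N0 \<union> {m02, m03}" using \<alpha>s by blast
      have sB: "?B \<subseteq> N1 \<union> {m12, m13}" using \<beta>s by blast
      have sK: "?K \<subseteq> N2 \<union> N3 \<union> {m02, m12, m03, m13, m23}" using K2s K3s by blast
      have "(N1 \<union> {m12, m13}) \<inter> (N0 \<union> {m02, m03}) = {}" by (simp_all add: sep)
      then have "(?B \<union> ?K) \<inter> (?A \<union> ?K) = ?K" using sA sB by blast
      moreover have "connected ?K" using K2 K3 by (intro connected_Un) auto
      ultimately show "connected ((?B \<union> ?K) \<inter> (?A \<union> ?K))" by simp
      show "connected_component (- (?B \<union> ?K)) z m01"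
      proof (rule reach)
        show "path_connected (insert m04 N4 \<union> insert m01 N0)" by (rule path_connected_link; simp add: pcs neN)
        have "(insert m04 N4 \<union> insert m01 N0) \<inter> (N1 \<union> {m12, m13} \<union> (N2 \<union> N3 \<union> {m02, m12, m03, m13, m23})) = {}"
          by (simp_all add: sep)
        then show "(insert m04 N4 \<union> insert m01 N0) \<inter> (?B \<union> ?K) = {}" using sB sK by blast
      qed (simp_all add: z)
      show "connected_component (- (?A \<union> ?K)) z m01"
      proof (rule reach)
        show "path_connected (insert m14 N4 \<union> insert m01 N1)" by (rule path_connected_link; simp add: pcs neN)
        have "(insert m14 N4 \<union> insert m01 N1) \<inter> (N0 \<union> {m02, m03} \<union> (N2 \<union> N3 \<union> {m02, m12, m03, m13, m23})) = {}"
          by (simp_all add: sep)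
        then show "(insert m14 N4 \<union> insert m01 N1) \<inter> (?A \<union> ?K) = {}" using sA sK by blast
      qed (simp_all add: z)
    qed
    moreover have "path_image a2 \<union> path_image a3 \<subseteq> (?B \<union> ?K) \<union> (?A \<union> ?K)"
      unfolding i2 i3 using K2(1) K3(1) by blast
    then have "- ((?B \<union> ?K) \<union> (?A \<union> ?K)) \<subseteq> - (path_image a2 \<union> path_image a3)" by (simp only: Compl_subset_Compl_iff)
    ultimately show ?thesis by (rule connected_component_of_subset)
  qed
  have dm: "X \<inter> Y = {}" if "X \<subseteq> A" "Y \<subseteq> B" "A \<inter> B = {}" for X Y A B :: "complex set" using that by blast
  have dm1: "X \<inter> Y = {x}" if "X \<subseteq> A" "Y \<subseteq> B" "A \<inter> B = {x}" "x \<in> X" "x \<in> Y" for X Y A B and x :: complex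
    using that by blast
  have d\<alpha>\<beta>: "path_image \<alpha>1 \<inter> path_image \<beta>1 = {m01}" "path_image \<alpha>1 \<inter> path_image \<beta>2 = {}" "path_image \<alpha>1 \<inter> path_image \<beta>3 = {}"
    "path_image \<alpha>2 \<inter> path_image \<beta>1 = {}" "path_image \<alpha>2 \<inter> path_image \<beta>2 = {}" "path_image \<alpha>2 \<inter> path_image \<beta>3 = {}"
    "path_image \<alpha>3 \<inter> path_image \<beta>1 = {}" "path_image \<alpha>3 \<inter> path_image \<beta>2 = {}" "path_image \<alpha>3 \<inter> path_image \<beta>3 = {}"
  proof -
    have 1: "insert m01 N0 \<inter> insert m01 N1 = {m01}" "insert m01 N0 \<inter> insert m12 N1 = {}" "insert m01 N0 \<inter> insert m13 N1 = {}"
       "insert m02 N0 \<inter> insert m01 N1 = {}" "insert m02 N0 \<inter> insert m12 N1 = {}" "insert m02 N0 \<inter> insert m13 N1 = {}"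
       "insert m03 N0 \<inter> insert m01 N1 = {}" "insert m03 N0 \<inter> insert m12 N1 = {}" "insert m03 N0 \<inter> insert m13 N1 = {}"
      by (simp_all add: sep)
    show "path_image \<alpha>1 \<inter> path_image \<beta>1 = {m01}" by (rule dm1[OF \<alpha>s(1) \<beta>s(1) 1(1)]; simp add: ends)
    show "path_image \<alpha>1 \<inter> path_image \<beta>2 = {}" by (rule dm[OF \<alpha>s(1) \<beta>s(2) 1(2)])
    show "path_image \<alpha>1 \<inter> path_image \<beta>3 = {}" by (rule dm[OF \<alpha>s(1) \<beta>s(3) 1(3)])
    show "path_image \<alpha>2 \<inter> path_image \<beta>1 = {}" by (rule dm[OF \<alpha>s(2) \<beta>s(1) 1(4)])
    show "path_image \<alpha>2 \<inter> path_image \<beta>2 = {}" by (rule dm[OF \<alpha>s(2) \<beta>s(2) 1(5)])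
    show "path_image \<alpha>2 \<inter> path_image \<beta>3 = {}" by (rule dm[OF \<alpha>s(2) \<beta>s(3) 1(6)])
    show "path_image \<alpha>3 \<inter> path_image \<beta>1 = {}" by (rule dm[OF \<alpha>s(3) \<beta>s(1) 1(7)])
    show "path_image \<alpha>3 \<inter> path_image \<beta>2 = {}" by (rule dm[OF \<alpha>s(3) \<beta>s(2) 1(8)])
    show "path_image \<alpha>3 \<inter> path_image \<beta>3 = {}" by (rule dm[OF \<alpha>s(3) \<beta>s(3) 1(9)])
  qed
  have dP: "path_image \<alpha>1 \<inter> path_image P2 = {}" "path_image \<alpha>2 \<inter> path_image P2 = {m02}" "path_image \<alpha>3 \<inter> path_image P2 = {}"
    "path_image \<alpha>1 \<inter> path_image P3 = {}" "path_image \<alpha>2 \<inter> path_image P3 = {}" "path_image \<alpha>3 \<inter> path_image P3 = {m03}"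
    "path_image \<beta>1 \<inter> path_image P2 = {}" "path_image \<beta>2 \<inter> path_image P2 = {m12}" "path_image \<beta>3 \<inter> path_image P2 = {}"
    "path_image \<beta>1 \<inter> path_image P3 = {}" "path_image \<beta>2 \<inter> path_image P3 = {}" "path_image \<beta>3 \<inter> path_image P3 = {m13}"
    "path_image P2 \<inter> path_image P3 = {}"
  proof -
    let ?Q2 = "insert m02 (insert m12 N2)" and ?Q3 = "insert m03 (insert m13 N3)"
    have 1: "insert m01 N0 \<inter> ?Q2 = {}" "insert m03 N0 \<inter> ?Q2 = {}" "insert m01 N0 \<inter> ?Q3 = {}" "insert m02 N0 \<inter> ?Q3 = {}"
      "insert m01 N1 \<inter> ?Q2 = {}" "insert m13 N1 \<inter> ?Q2 = {}" "insert m01 N1 \<inter> ?Q3 = {}" "insert m12 N1 \<inter> ?Q3 = {}"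
      "?Q2 \<inter> ?Q3 = {}"
      by (simp_all add: sep)
    have 2: "insert m02 N0 \<inter> ?Q2 = {m02}" "insert m03 N0 \<inter> ?Q3 = {m03}" "insert m12 N1 \<inter> ?Q2 = {m12}" "insert m13 N1 \<inter> ?Q3 = {m13}"
      by (simp_all add: sep)
    show "path_image \<alpha>2 \<inter> path_image P2 = {m02}" by (rule dm1[OF \<alpha>s(2) P2s 2(1)]; simp add: ends)
    show "path_image \<alpha>3 \<inter> path_image P3 = {m03}" by (rule dm1[OF \<alpha>s(3) P3s 2(2)]; simp add: ends)
    show "path_image \<beta>2 \<inter> path_image P2 = {m12}" by (rule dm1[OF \<beta>s(2) P2s 2(3)]; simp add: ends)
    show "path_image \<beta>3 \<inter> path_image P3 = {m13}" by (rule dm1[OF \<beta>s(3) P3s 2(4)]; simp add: ends)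
    show "path_image \<alpha>1 \<inter> path_image P2 = {}" by (rule dm[OF \<alpha>s(1) P2s 1(1)])
    show "path_image \<alpha>3 \<inter> path_image P2 = {}" by (rule dm[OF \<alpha>s(3) P2s 1(2)])
    show "path_image \<alpha>1 \<inter> path_image P3 = {}" by (rule dm[OF \<alpha>s(1) P3s 1(3)])
    show "path_image \<alpha>2 \<inter> path_image P3 = {}" by (rule dm[OF \<alpha>s(2) P3s 1(4)])
    show "path_image \<beta>1 \<inter> path_image P2 = {}" by (rule dm[OF \<beta>s(1) P2s 1(5)])
    show "path_image \<beta>3 \<inter> path_image P2 = {}" by (rule dm[OF \<beta>s(3) P2s 1(6)])
    show "path_image \<beta>1 \<inter> path_image P3 = {}" by (rule dm[OF \<beta>s(1) P3s 1(7)])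
    show "path_image \<beta>2 \<inter> path_image P3 = {}" by (rule dm[OF \<beta>s(2) P3s 1(8)])
    show "path_image P2 \<inter> path_image P3 = {}" by (rule dm[OF P2s P3s 1(9)])
  qed
  have comm: "path_image P2 \<inter> path_image \<beta>1 = {}" "path_image P2 \<inter> path_image \<beta>2 = {m12}" "path_image P2 \<inter> path_image \<beta>3 = {}"
    "path_image P3 \<inter> path_image \<beta>1 = {}" "path_image P3 \<inter> path_image \<beta>2 = {}" "path_image P3 \<inter> path_image \<beta>3 = {m13}"
    "path_image P2 \<inter> path_image \<alpha>3 = {}" "path_image \<beta>1 \<inter> path_image \<alpha>2 = {}" "path_image \<beta>1 \<inter> path_image \<alpha>3 = {}"
    "path_image \<beta>2 \<inter> path_image \<alpha>3 = {}" 
    using dP d\<alpha>\<beta> by (simp_all only: Int_commute)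
  note ints = d\<alpha>\<beta> dP comm \<alpha>i \<beta>i
  show False
  proof (rule theta_separation[of a1 a2 a3 u v m01 m02 m03 z])
    show "arc a1" unfolding a1_def
      by (intro arc_join) (simp_all add: arc_reversepath \<alpha> \<beta> ints)
    show "arc a2" unfolding a2_def
      by (intro arc_join) (simp_all add: arc_reversepath path_image_join \<alpha> \<beta> P2 ints Int_Un_distrib)
    show "arc a3" unfolding a3_def
      by (intro arc_join) (simp_all add: arc_reversepath path_image_join \<alpha> \<beta> P3 ints Int_Un_distrib)
    show "path_image a1 \<inter> path_image a2 = {u, v}" "path_image a1 \<inter> path_image a3 = {u, v}"
      "path_image a2 \<inter> path_image a3 = {u, v}"
      unfolding i1 i2 i3 Int_Un_distrib Int_Un_distrib2 by (simp_all only: ints Un_empty_left Un_empty_right insert_is_Un[symmetric])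
    show "pathstart a1 = u" "pathfinish a1 = v" "pathstart a2 = u" "pathfinish a2 = v"
      "pathstart a3 = u" "pathfinish a3 = v"
      by (simp_all add: a1_def a2_def a3_def \<alpha> \<beta>)
    show "m01 \<in> path_image a1" "m02 \<in> path_image a2" "m03 \<in> path_image a3"
      by (simp_all add: i1 i2 i3 ends)
  qed (fact z1 z2 z3)+
qed

section \<open>Minors and drawings\<close>

text \<open>The empty set counts as connected; contractions rely on this when they give an empty
  branch set to a vertex that disappears.\<close>

definition connected_in :: "('a \<times> 'a) set \<Rightarrow> 'a set \<Rightarrow> bool" where
  "connected_in E X \<longleftrightarrow> (\<forall>x\<in>X. \<forall>y\<in>X. (x, y) \<in> (E \<inter> X \<times> X)\<^sup>*)"

definition K5_minor :: "('a \<times> 'a) set \<Rightarrow> bool" where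
  "K5_minor E \<longleftrightarrow> (\<exists>X :: nat \<Rightarrow> 'a set.
     (\<forall>i<5. X i \<noteq> {} \<and> connected_in E (X i)) \<and>
     (\<forall>i<5. \<forall>j<5. i \<noteq> j \<longrightarrow> X i \<inter> X j = {} \<and> (\<exists>x\<in>X i. \<exists>y\<in>X j. (x, y) \<in> E)))"

text \<open>Cutting every edge at its midpoint splits a drawing into disjoint stars.\<close>

definition half :: "('a \<Rightarrow> complex) \<Rightarrow> ('a set \<Rightarrow> real \<Rightarrow> complex) \<Rightarrow> 'a \<Rightarrow> 'a set \<Rightarrow> complex set" where
  "half p c u e = c e ` (if pathstart (c e) = p u then {0..<1/2} else {1/2<..1})"

definition star :: "'a set set \<Rightarrow> ('a \<Rightarrow> complex) \<Rightarrow> ('a set \<Rightarrow> real \<Rightarrow> complex) \<Rightarrow> 'a \<Rightarrow> complex set" where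
  "star Es p c u = insert (p u) (\<Union>e\<in>{e\<in>Es. u \<in> e}. half p c u e)"

section \<open>Half-edges, stars and blobs in a fixed plane drawing\<close>

context
  fixes G :: "'a pair_pre_digraph" and p :: "'a \<Rightarrow> complex" and c :: "'a set \<Rightarrow> real \<Rightarrow> complex"
  assumes G: "pair_graph G" and draw: "plane_drawing G p c"
begin

lemma edgeE:
  assumes "e \<in> edge_set G"
  obtains u v where "e = {u, v}" "u \<noteq> v" "u \<in> pverts G" "v \<in> pverts G" "(u, v) \<in> parcs G"
proof -
  interpret pair_graph G by (rule G)
  obtain u v where uv: "e = {u, v}" "(u, v) \<in> parcs G" using assms by (auto simp: edge_set_def)
  then show thesis using that[of u v] arc_fst_in_verts[of "(u,v)"] arc_snd_in_verts[of "(u,v)"] no_loops[of "(u,v)"] by auto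
qed

lemma edge_arc:
  assumes "e \<in> edge_set G"
  shows "arc (c e)" "{c e 0, c e 1} = p ` e" "path_image (c e) \<inter> p ` pverts G = p ` e"
proof -
  have "\<forall>e \<in> edge_set G. arc (c e) \<and> {pathstart (c e), pathfinish (c e)} = p ` e \<and>
        path_image (c e) \<inter> p ` pverts G = p ` e"
    using draw unfolding plane_drawing_def by (elim conjE)
  from bspec[OF this assms]
  show "arc (c e)" "{c e 0, c e 1} = p ` e" "path_image (c e) \<inter> p ` pverts G = p ` e"
    unfolding pathstart_def pathfinish_def by simp_all
qed

lemma curve_inj:
  assumes "e \<in> edge_set G" "s \<in> {0..1}" "t \<in> {0..1}" "c e s = c e t"
  shows "s = t"
  using edge_arc(1)[OF assms(1)] assms(2-4) unfolding arc_def inj_on_def by blast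

lemma p_inj: "u \<in> pverts G \<Longrightarrow> v \<in> pverts G \<Longrightarrow> p u = p v \<Longrightarrow> u = v"
  using draw unfolding plane_drawing_def inj_on_def by blast

lemma vertex_on_curve:
  assumes "e \<in> edge_set G" "t \<in> {0..1}" "c e t = p v" "v \<in> pverts G"
  shows "t \<in> {0, 1}"
proof -
  have "c e t \<in> path_image (c e)" unfolding path_image_def using assms(2) by (rule imageI)
  moreover have "c e t \<in> p ` pverts G" using assms(3,4) by simp
  ultimately have "c e t \<in> path_image (c e) \<inter> p ` pverts G" by (rule IntI)
  then have "c e t \<in> {c e 0, c e 1}" using edge_arc(2,3)[OF assms(1)] by simp
  then show ?thesis using curve_inj[OF assms(1,2)] by auto
qed

lemma curves_meet:
  assumes "e \<in> edge_set G" "f \<in> edge_set G" "e \<noteq> f" "s \<in> {0..1}" "t \<in> {0..1}" "c e s = c f t"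
  shows "\<exists>v\<in>e \<inter> f. c e s = p v"
proof -
  have "c e s \<in> path_image (c e)" unfolding path_image_def using assms(4) by (rule imageI)
  moreover have "c e s \<in> path_image (c f)" unfolding assms(6) path_image_def using assms(5) by (rule imageI)
  ultimately have "c e s \<in> p ` (e \<inter> f)" using draw assms(1-3) unfolding plane_drawing_def by blast
  then show ?thesis by auto
qed

lemma half_cases:
  assumes "e \<in> edge_set G" "u \<in> e"
  obtains "c e 0 = p u" "half p c u e = c e ` {0..<1/2}"
  | "c e 0 \<noteq> p u" "c e 1 = p u" "half p c u e = c e ` {1/2<..1}"
proof (cases "c e 0 = p u")
  case True
  then show ?thesis using that(1) by (simp add: half_def pathstart_def)
next
  case False
  then have "c e 1 = p u" using edge_arc(2)[OF assms(1)] assms(2) by (metis imageI insertE singletonD)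
  then show ?thesis using that(2) False by (simp add: half_def pathstart_def)
qed

lemma vertex_in_half:
  assumes "e \<in> edge_set G" "u \<in> e" "v \<in> pverts G" "p v \<in> half p c u e"
  shows "v = u"
proof -
  have u: "u \<in> pverts G" using assms(1,2) by (elim edgeE) auto
  have "p v = p u"
  proof (rule half_cases[OF assms(1,2)])
    assume h: "c e 0 = p u" "half p c u e = c e ` {0..<1/2}"
    then obtain t where t: "t \<in> {0..<1/2}" "p v = c e t" using assms(4) by auto
    then have "t \<in> {0, 1}" using vertex_on_curve[OF assms(1) _ _ assms(3), of t] by auto
    then show ?thesis using t h by auto
  next
    assume h: "c e 1 = p u" "half p c u e = c e ` {1/2<..1}"
    then obtain t where t: "t \<in> {1/2<..1}" "p v = c e t" using assms(4) by auto
    then have "t \<in> {0, 1}" using vertex_on_curve[OF assms(1) _ _ assms(3), of t] by auto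
    then show ?thesis using t h by auto
  qed
  then show ?thesis using p_inj u assms(3) by blast
qed

lemma half_subset:
  assumes "x \<in> half p c u e"
  obtains t where "t \<in> {0..1}" "t \<noteq> 1/2" "x = c e t"
proof -
  obtain t where "t \<in> (if pathstart (c e) = p u then {0..<1/2} else {1/2<..1})" "x = c e t"
    using assms unfolding half_def by (rule imageE)
  then show thesis using that[of t] by (auto split: if_splits)
qed

text \<open>Curves of different edges meet only in a drawn common end, and a half contains no drawn
  vertex but its own. On a single curve the two halves lie on different sides of the midpoint, which
  belongs to neither.\<close>

lemma halves_disjoint:
  assumes "e \<in> edge_set G" "f \<in> edge_set G" "u \<in> e" "w \<in> f" "u \<noteq> w"
  shows "half p c u e \<inter> half p c w f = {}"
proof (rule ccontr)
  assume "half p c u e \<inter> half p c w f \<noteq> {}"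
  then obtain x where x: "x \<in> half p c u e" "x \<in> half p c w f" by auto
  obtain s where s: "s \<in> {0..1}" "x = c e s" using x(1) by (rule half_subset)
  obtain t where t: "t \<in> {0..1}" "x = c f t" using x(2) by (rule half_subset)
  show False
  proof (cases "e = f")
    case False
    then obtain v where v: "v \<in> e" "x = p v" using curves_meet[OF assms(1,2) False s(1) t(1)] s t by auto
    have "v \<in> pverts G" using assms(1) v(1) by (elim edgeE) auto
    then show False using vertex_in_half x v assms by metis
  next
    case True
    have vu: "u \<in> pverts G" "w \<in> pverts G" using assms by (auto elim!: edgeE)
    have ne: "p u \<noteq> p w" using p_inj vu assms(5) by blast
    have no: False if xe: "x \<in> c e ` {0..<1/2}" "x \<in> c e ` {1/2<..1}"
    proof -
      obtain r where "r \<in> {0..<1/2}" "x = c e r" using xe(1) by auto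
      moreover obtain r' where "r' \<in> {1/2<..1}" "x = c e r'" using xe(2) by auto
      ultimately have "r \<in> {0..<1/2}" "r' \<in> {1/2<..1}" "c e r = c e r'" by auto
      then show False using curve_inj[OF assms(1), of r r'] by auto
    qed
    show False
      by (rule half_cases[OF assms(1,3)]; rule half_cases[OF assms(2,4)]) (use no x ne True in metis)+
  qed
qed

lemma stars_disjoint:
  assumes "u \<in> pverts G" "w \<in> pverts G" "u \<noteq> w"
  shows "star (edge_set G) p c u \<inter> star (edge_set G) p c w = {}"
proof -
  have "p u \<noteq> p w" using p_inj assms by blast
  moreover have "p u \<notin> half p c w e" if "e \<in> edge_set G" "w \<in> e" for e
    using vertex_in_half[OF that assms(1)] assms(3) by blast
  moreover have "p w \<notin> half p c u e" if "e \<in> edge_set G" "u \<in> e" for e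
    using vertex_in_half[OF that assms(2)] assms(3) by blast
  moreover have "half p c u e \<inter> half p c w f = {}" if "e \<in> edge_set G" "f \<in> edge_set G" "u \<in> e" "w \<in> f" for e f
    using halves_disjoint[OF that assms(3)] .
  ultimately show ?thesis unfolding star_def by fast
qed

lemma mid_not_vertex:
  assumes "e \<in> edge_set G" "v \<in> pverts G"
  shows "c e (1/2) \<noteq> p v"
  using vertex_on_curve[OF assms(1) _ _ assms(2), of "1/2"] by auto

lemma mid_inj:
  assumes "e \<in> edge_set G" "f \<in> edge_set G" "t \<in> {0..1}" "c e (1/2) = c f t"
  shows "e = f" "t = 1/2"
proof -
  show "e = f"
  proof (rule ccontr)
    assume "e \<noteq> f"
    then obtain v where "v \<in> e" "c e (1/2) = p v" using curves_meet[OF assms(1,2) _ _ assms(3,4)] by auto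
    moreover have "v \<in> pverts G" using assms(1) \<open>v \<in> e\<close> by (elim edgeE) auto
    ultimately show False using mid_not_vertex[OF assms(1)] by blast
  qed
  then show "t = 1/2" using curve_inj[OF assms(2) assms(3), of "1/2"] assms(4) by auto
qed

lemma mid_not_in_star:
  assumes "e \<in> edge_set G" "u \<in> pverts G"
  shows "c e (1/2) \<notin> star (edge_set G) p c u"
proof
  assume "c e (1/2) \<in> star (edge_set G) p c u"
  then obtain f where f: "f \<in> edge_set G" "c e (1/2) \<in> half p c u f"
    using mid_not_vertex[OF assms] by (auto simp: star_def)
  obtain t where "t \<in> {0..1}" "t \<noteq> 1/2" "c e (1/2) = c f t" using f(2) by (rule half_subset)
  then show False using mid_inj[OF assms(1) f(1)] by blast
qed

lemma path_connected_half:
  assumes "e \<in> edge_set G" "u \<in> e"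
  shows "path_connected (insert (p u) (half p c u e))"
    and "path_connected (insert (p u) (insert (c e (1/2)) (half p c u e)))"
proof -
  have ct: "path_connected (c e ` S)" if "S \<subseteq> {0..1}" "convex S" for S :: "real set"
  proof (rule path_connected_continuous_image)
    have "continuous_on {0..1} (c e)" using edge_arc(1)[OF assms(1)] by (simp add: arc_def path_def)
    then show "continuous_on S (c e)" using that(1) by (rule continuous_on_subset)
    show "path_connected S" using that(2) by (rule convex_imp_path_connected)
  qed
  show "path_connected (insert (p u) (half p c u e))"
  proof (rule half_cases[OF assms])
    assume h: "c e 0 = p u" "half p c u e = c e ` {0..<1/2}"
    then have "insert (p u) (half p c u e) = c e ` {0..<1/2}" by force
    moreover have "path_connected (c e ` {0..<1/2})" by (rule ct) (auto simp: convex_real_interval)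
    ultimately show ?thesis by simp
  next
    assume h: "c e 1 = p u" "half p c u e = c e ` {1/2<..1}"
    then have "insert (p u) (half p c u e) = c e ` {1/2<..1}" by force
    moreover have "path_connected (c e ` {1/2<..1})" by (rule ct) (auto simp: convex_real_interval)
    ultimately show ?thesis by simp
  qed
  show "path_connected (insert (p u) (insert (c e (1/2)) (half p c u e)))"
  proof (rule half_cases[OF assms])
    assume h: "c e 0 = p u" "half p c u e = c e ` {0..<1/2}"
    have "{0..1/2} = insert (0::real) (insert (1/2) {0..<1/2})" by auto
    then have "c e ` {0..1/2} = insert (c e 0) (insert (c e (1/2)) (c e ` {0..<1/2}))" by (metis image_insert)
    then have "insert (p u) (insert (c e (1/2)) (half p c u e)) = c e ` {0..1/2}" using h by simp
    then show ?thesis using ct[of "{0..1/2}"] by simp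
  next
    assume h: "c e 1 = p u" "half p c u e = c e ` {1/2<..1}"
    have "{1/2..1} = insert (1::real) (insert (1/2) {1/2<..1})" by auto
    then have "c e ` {1/2..1} = insert (c e 1) (insert (c e (1/2)) (c e ` {1/2<..1}))" by (metis image_insert)
    then have "insert (p u) (insert (c e (1/2)) (half p c u e)) = c e ` {1/2..1}" using h by simp
    then show ?thesis using ct[of "{1/2..1}"] by simp
  qed
qed

lemma path_connected_star: "path_connected (star (edge_set G) p c u)"
proof -
  have "star (edge_set G) p c u =
      (\<Union>S\<in>insert {p u} ((\<lambda>e. insert (p u) (half p c u e)) ` {e \<in> edge_set G. u \<in> e}). S)"
    by (auto simp: star_def)
  also have "path_connected \<dots>"
    by (rule path_connected_UNION[where z = "p u"]) (auto intro: path_connected_half)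
  finally show ?thesis .
qed

lemma path_connected_star_mid:
  assumes "e \<in> edge_set G" "u \<in> e"
  shows "path_connected (insert (c e (1/2)) (star (edge_set G) p c u))"
proof -
  have "insert (c e (1/2)) (star (edge_set G) p c u)
      = insert (p u) (insert (c e (1/2)) (half p c u e)) \<union> star (edge_set G) p c u"
    using assms by (auto simp: star_def)
  also have "path_connected \<dots>"
    using path_connected_half(2)[OF assms] path_connected_star
    by (intro path_connected_Un) (auto simp: star_def)
  finally show ?thesis .
qed

text \<open>The region occupied by the subgraph induced on \<open>X\<close>. Midpoints of edges
  leaving \<open>X\<close> are excluded: they are the points where two disjoint blobs touch.\<close>

definition blob :: "'a set \<Rightarrow> complex set" where
  "blob X = (\<Union>u\<in>X. star (edge_set G) p c u) \<union> (\<lambda>e. c e (1/2)) ` {e \<in> edge_set G. e \<subseteq> X}"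

lemma path_connected_blob:
  assumes "connected_in (parcs G) X"
  shows "path_connected (blob X)"
proof -
  have st: "path_component (blob X) x y" if "u \<in> X" "x \<in> star (edge_set G) p c u" "y \<in> star (edge_set G) p c u" for u x y
  proof -
    have "path_component (star (edge_set G) p c u) x y"
      using path_connected_star that(2,3) by (simp add: path_connected_component)
    then show ?thesis by (rule path_component_of_subset[rotated]) (use that(1) in \<open>auto simp: blob_def\<close>)
  qed
  have sm: "path_component (blob X) (p u) (c e (1/2))" if "e \<in> edge_set G" "e \<subseteq> X" "u \<in> e" for e u
  proof -
    have "path_component (insert (c e (1/2)) (star (edge_set G) p c u)) (p u) (c e (1/2))"
      using path_connected_star_mid[OF that(1,3)] by (simp add: path_connected_component star_def)
    then show ?thesis by (rule path_component_of_subset[rotated]) (use that in \<open>auto simp: blob_def\<close>)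
  qed
  have pp: "path_component (blob X) (p u) (p v)" if "u \<in> X" "v \<in> X" for u v
  proof -
    have "(u, v) \<in> (parcs G \<inter> X \<times> X)\<^sup>*" using assms that by (auto simp: connected_in_def)
    then show ?thesis
    proof (induction rule: rtrancl_induct)
      case base
      show ?case using st[OF that(1)] by (simp add: star_def)
    next
      case (step v w)
      then have "{v, w} \<in> edge_set G" "{v, w} \<subseteq> X" by (auto simp: edge_set_def)
      then have "path_component (blob X) (p v) (c {v, w} (1/2))" "path_component (blob X) (p w) (c {v, w} (1/2))"
        using sm by auto
      then show ?case using step.IH path_component_sym path_component_trans by metis
    qed
  qed
  have "\<exists>u\<in>X. path_component (blob X) (p u) x" if x: "x \<in> blob X" for x
  proof -
    consider u where "u \<in> X" "x \<in> star (edge_set G) p c u" | e where "e \<in> edge_set G" "e \<subseteq> X" "x = c e (1/2)"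
      using x unfolding blob_def by blast
    then show ?thesis
    proof cases
      case 1
      then show ?thesis using st[of u "p u" x] by (auto simp: star_def)
    next
      case 2
      then obtain u where "u \<in> e" by (elim edgeE) auto
      then show ?thesis using sm 2 by blast
    qed
  qed
  then show ?thesis unfolding path_connected_component using pp path_component_sym path_component_trans by metis
qed

lemma path_connected_blob_mid:
  assumes "connected_in (parcs G) X" "e \<in> edge_set G" "e \<inter> X \<noteq> {}"
  shows "path_connected (insert (c e (1/2)) (blob X))"
proof -
  obtain u where u: "u \<in> e" "u \<in> X" using assms(3) by auto
  have "insert (c e (1/2)) (blob X) = insert (c e (1/2)) (star (edge_set G) p c u) \<union> blob X"
    using u by (auto simp: blob_def)
  also have "path_connected \<dots>"
    using path_connected_star_mid[OF assms(2) u(1)] path_connected_blob[OF assms(1)] u(2)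
    by (intro path_connected_Un) (auto simp: blob_def star_def)
  finally show ?thesis .
qed

lemma blobs_disjoint:
  assumes "X \<subseteq> pverts G" "Y \<subseteq> pverts G" "X \<inter> Y = {}"
  shows "blob X \<inter> blob Y = {}"
proof -
  have "star (edge_set G) p c u \<inter> star (edge_set G) p c w = {}" if "u \<in> X" "w \<in> Y" for u w
    using that assms by (intro stars_disjoint) auto
  moreover have "c e (1/2) \<notin> star (edge_set G) p c u" if "e \<in> edge_set G" "u \<in> X \<union> Y" for e u
    using that assms by (intro mid_not_in_star) auto
  moreover have "c e (1/2) \<noteq> c f (1/2)" if "e \<in> edge_set G" "f \<in> edge_set G" "e \<subseteq> X" "f \<subseteq> Y" for e f
  proof
    assume "c e (1/2) = c f (1/2)"
    then have "e = f" using mid_inj(1)[OF that(1,2), of "1/2"] by simp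
    then have "e = {}" using that assms(3) by auto
    then show False using that(1) by (elim edgeE) auto
  qed
  ultimately show ?thesis unfolding blob_def by fast
qed

lemma mid_not_in_blob:
  assumes "X \<subseteq> pverts G" "e \<in> edge_set G" "\<not> e \<subseteq> X"
  shows "c e (1/2) \<notin> blob X"
  using mid_not_in_star[OF assms(2)] mid_inj(1)[OF assms(2), of _ "1/2"] assms by (auto simp: blob_def)

text \<open>The blobs of the five branch sets, together with the midpoints of ten connecting edges,
  would form the configuration excluded by \<open>no_five_mutually_touching\<close>.\<close>

lemma drawing_no_K5_minor: "\<not> K5_minor (parcs G)"
proof
  assume "K5_minor (parcs G)"
  then obtain X :: "nat \<Rightarrow> 'a set" where X5: "\<forall>i<5. X i \<noteq> {} \<and> connected_in (parcs G) (X i)"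
    "\<forall>i<5. \<forall>j<5. i \<noteq> j \<longrightarrow> X i \<inter> X j = {} \<and> (\<exists>x\<in>X i. \<exists>y\<in>X j. (x, y) \<in> parcs G)"
    unfolding K5_minor_def by (elim exE conjE)
  have X: "\<And>i. i < 5 \<Longrightarrow> X i \<noteq> {}" "\<And>i. i < 5 \<Longrightarrow> connected_in (parcs G) (X i)"
    and XX: "\<And>i j. i < 5 \<Longrightarrow> j < 5 \<Longrightarrow> i \<noteq> j \<Longrightarrow> X i \<inter> X j = {}"
       "\<And>i j. i < 5 \<Longrightarrow> j < 5 \<Longrightarrow> i \<noteq> j \<Longrightarrow> \<exists>x\<in>X i. \<exists>y\<in>X j. (x, y) \<in> parcs G"
    using X5 by simp_all
  interpret pair_graph G by (rule G)
  \<comment> \<open>Branch sets are not confined to the vertex set by definition. Each contains an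
    end of an arc leading to another branch set, and connectedness makes all its other members ends
    of arcs too.\<close>
  have XV: "X i \<subseteq> pverts G" if i5: "i < 5" for i
  proof
    fix x assume x: "x \<in> X i"
    define j :: nat where "j = (if i = 0 then 1 else 0)"
    have j: "j < 5" "i \<noteq> j" by (auto simp: j_def)
    obtain y z where yz: "y \<in> X i" "(y, z) \<in> parcs G" using XX(2)[OF i5 j] by blast
    have "(x, y) \<in> (parcs G \<inter> X i \<times> X i)\<^sup>*" using X(2)[OF i5] x yz(1) by (simp add: connected_in_def)
    then show "x \<in> pverts G"
      using yz(2) in_arcsD1 by (cases rule: converse_rtranclE) auto
  qed
  \<comment> \<open>Choosing the edge for the unordered pair \<open>{i, j}\<close> makes the
    touching point symmetric in \<open>i\<close> and \<open>j\<close>.\<close>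
  define ed where "ed S = (SOME e. e \<in> edge_set G \<and> (\<forall>i\<in>S. e \<inter> X i \<noteq> {}))" for S
  have ed: "ed {i, j} \<in> edge_set G" "ed {i, j} \<inter> X i \<noteq> {}" "ed {i, j} \<inter> X j \<noteq> {}"
    if ij: "i < 5" "j < 5" "i \<noteq> j" for i j
  proof -
    obtain x y where "x \<in> X i" "y \<in> X j" "(x, y) \<in> parcs G" using XX(2)[OF ij] by blast
    then have "{x, y} \<in> edge_set G \<and> (\<forall>k\<in>{i, j}. {x, y} \<inter> X k \<noteq> {})" by (auto simp: edge_set_def)
    then have "ed {i, j} \<in> edge_set G \<and> (\<forall>k\<in>{i, j}. ed {i, j} \<inter> X k \<noteq> {})" unfolding ed_def by (rule someI)
    then show "ed {i, j} \<in> edge_set G" "ed {i, j} \<inter> X i \<noteq> {}" "ed {i, j} \<inter> X j \<noteq> {}" by auto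
  qed
  \<comment> \<open>An edge has two ends, so it meets at most two of the disjoint branch sets; hence
    different pairs receive different edges, and these have different midpoints.\<close>
  have two: "k \<in> {i, j}" if e: "e \<in> edge_set G" and "e \<inter> X i \<noteq> {}" "e \<inter> X j \<noteq> {}" "e \<inter> X k \<noteq> {}"
    and lt: "i < 5" "j < 5" "k < 5" "i \<noteq> j" for e i j k
  proof (rule ccontr)
    assume "k \<notin> {i, j}"
    then have "X i \<inter> X j = {}" "X i \<inter> X k = {}" "X j \<inter> X k = {}" using XX(1) lt by auto
    moreover obtain u v where "e = {u, v}" using e by (elim edgeE) auto
    ultimately show False using that(2-4) by blast
  qed
  show False
  proof (rule no_five_mutually_touching[of "\<lambda>i. blob (X i)" "\<lambda>i j. c (ed {i, j}) (1/2)"])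
    show "blob (X i) \<noteq> {}" if "i < 5" for i using X(1)[OF that] by (auto simp: blob_def star_def)
    show "blob (X i) \<inter> blob (X j) = {}" if "i < 5" "j < 5" "i \<noteq> j" for i j
      using XV XX(1) that by (intro blobs_disjoint) auto
    show "path_connected (insert (c (ed {i, j}) (1/2)) (blob (X i)))" if "i < 5" "j < 5" "i \<noteq> j" for i j
      using ed[OF that] X(2) that by (intro path_connected_blob_mid) auto
    show "c (ed {i, j}) (1/2) = c (ed {j, i}) (1/2)" for i j by (simp add: insert_commute)
    show "{i, j} = {k, l}" if lt: "i < 5" "j < 5" "i \<noteq> j" "k < 5" "l < 5" "k \<noteq> l"
      and "c (ed {i, j}) (1/2) = c (ed {k, l}) (1/2)" for i j k l
    proof -
      have "ed {i, j} = ed {k, l}" using mid_inj(1)[OF ed(1)[OF lt(1-3)] ed(1)[OF lt(4-6)], of "1/2"] that(7) by simp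
      then have "k \<in> {i, j}" "l \<in> {i, j}"
        using ed[OF lt(1-3)] ed[OF lt(4-6)] two lt by metis+
      then show ?thesis using lt by auto
    qed
    show "c (ed {i, j}) (1/2) \<notin> blob (X k)" if "i < 5" "j < 5" "i \<noteq> j" "k < 5" for i j k
    proof (rule mid_not_in_blob)
      have "k \<noteq> i \<or> k \<noteq> j" using that by auto
      then show "\<not> ed {i, j} \<subseteq> X k" using ed[OF that(1-3)] XX(1) that by blast
    qed (use XV ed that in auto)
  qed
qed

end

lemma planar_no_K5_minor:
  assumes "pair_graph G" "planar G"
  shows "\<not> K5_minor (parcs G)"
  using assms drawing_no_K5_minor unfolding planar_def by blast

section \<open>Mader's edge bound\<close>

text \<open>Transitivity of the minor relation: the branch sets of the K5 in \<open>F\<close> are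
  expanded by replacing each vertex \<open>w\<close> with \<open>B w\<close>. All contractions below
  are instances.\<close>

lemma K5_minor_of_branch_sets:
  assumes F: "K5_minor F"
    and disj: "\<And>w w'. w \<noteq> w' \<Longrightarrow> B w \<inter> B w' = {}"
    and conn: "\<And>w. connected_in E (B w)"
    and edge: "\<And>x y. (x, y) \<in> F \<Longrightarrow> \<exists>x'\<in>B x. \<exists>y'\<in>B y. (x', y') \<in> E"
  shows "K5_minor E"
proof -
  obtain X :: "nat \<Rightarrow> 'a set" where X: "\<forall>i<5. X i \<noteq> {} \<and> connected_in F (X i)"
    "\<forall>i<5. \<forall>j<5. i \<noteq> j \<longrightarrow> X i \<inter> X j = {} \<and> (\<exists>x\<in>X i. \<exists>y\<in>X j. (x, y) \<in> F)"
    using F unfolding K5_minor_def by (elim exE conjE)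
  define Y where "Y i = (\<Union>w\<in>X i. B w)" for i
  have adj: "\<exists>x\<in>Y i. \<exists>y\<in>Y j. (x, y) \<in> E" if ij: "i < 5" "j < 5" "i \<noteq> j" for i j
  proof -
    obtain x y where xy: "x \<in> X i" "y \<in> X j" "(x, y) \<in> F" using X(2) ij by blast
    then show ?thesis using edge[OF xy(3)] unfolding Y_def by blast
  qed
  have "connected_in E (Y i)" if i: "i < 5" for i
  proof -
    have in_B: "(x, y) \<in> (E \<inter> Y i \<times> Y i)\<^sup>*" if w: "w \<in> X i" "x \<in> B w" "y \<in> B w" for w x y
    proof -
      have "(x, y) \<in> (E \<inter> B w \<times> B w)\<^sup>*" using conn[of w] w by (auto simp: connected_in_def)
      then show ?thesis by (rule rtrancl_mono[THEN subsetD, rotated]) (use w in \<open>auto simp: Y_def\<close>)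
    qed
    have path: "\<forall>x\<in>B w. \<forall>y\<in>B w'. (x, y) \<in> (E \<inter> Y i \<times> Y i)\<^sup>*"
      if w: "(w, w') \<in> (F \<inter> X i \<times> X i)\<^sup>*" "w \<in> X i" for w w'
      using w(1)
    proof (induction rule: rtrancl_induct)
      case base
      then show ?case using in_B w(2) by blast
    next
      case (step w1 w2)
      then obtain x' y' where e: "x' \<in> B w1" "y' \<in> B w2" "(x', y') \<in> E" using edge by blast
      have "(x', y') \<in> E \<inter> Y i \<times> Y i" using e step.hyps by (auto simp: Y_def)
      moreover have "(y', y) \<in> (E \<inter> Y i \<times> Y i)\<^sup>*" if "y \<in> B w2" for y
        using in_B[OF _ e(2) that] step.hyps by blast
      ultimately show ?case using step.IH e(1) by (meson rtrancl.rtrancl_into_rtrancl rtrancl_trans)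
    qed
    show ?thesis unfolding connected_in_def
    proof (intro ballI)
      fix x y assume "x \<in> Y i" "y \<in> Y i"
      then obtain w w' where w: "w \<in> X i" "w' \<in> X i" "x \<in> B w" "y \<in> B w'" by (auto simp: Y_def)
      then have "(w, w') \<in> (F \<inter> X i \<times> X i)\<^sup>*" using X(1) i by (auto simp: connected_in_def)
      then show "(x, y) \<in> (E \<inter> Y i \<times> Y i)\<^sup>*" using path w by blast
    qed
  qed
  \<comment> \<open>Single sets \<open>B w\<close> may be empty, so an element of \<open>Y i\<close>
    is taken from an edge to another \<open>Y j\<close>.\<close>
  moreover have "Y i \<noteq> {}" if "i < 5" for i
  proof -
    define j :: nat where "j = (if i = 0 then 1 else 0)"
    have "j < 5" "i \<noteq> j" by (auto simp: j_def)
    then show ?thesis using adj[OF that, of j] by auto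
  qed
  moreover have "Y i \<inter> Y j = {}" if ij: "i < 5" "j < 5" "i \<noteq> j" for i j
  proof (rule ccontr)
    assume "Y i \<inter> Y j \<noteq> {}"
    then obtain w w' z where w: "w \<in> X i" "w' \<in> X j" "z \<in> B w" "z \<in> B w'" by (auto simp: Y_def)
    moreover have "X i \<inter> X j = {}" using X(2) ij by blast
    ultimately have "w \<noteq> w'" by auto
    then show False using disj[of w w'] w by blast
  qed
  ultimately show ?thesis unfolding K5_minor_def using adj by (intro exI[of _ Y]) simp
qed

lemma connected_in_single: "connected_in E {x}"
  by (simp add: connected_in_def)

lemma connected_in_pair:
  assumes "(x, y) \<in> E" "sym E"
  shows "connected_in E {x, y}"
proof -
  have "(y, x) \<in> E" using assms by (auto dest: symD)
  then have "(x, y) \<in> E \<inter> {x, y} \<times> {x, y}" "(y, x) \<in> E \<inter> {x, y} \<times> {x, y}" using assms by auto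
  from this[THEN r_into_rtrancl] show ?thesis unfolding connected_in_def by auto
qed

lemma K5_minor_mono: "K5_minor F \<Longrightarrow> F \<subseteq> E \<Longrightarrow> K5_minor E"
  by (erule K5_minor_of_branch_sets[where B = "\<lambda>w. {w}"]) (auto simp: connected_in_single)

text \<open>Leaves just ten adjacencies to check for an explicit minor, one for each pair in list
  order; symmetry of \<open>E\<close> supplies the others.\<close>

lemma K5_minor_list:
  assumes "sym E" "length Xs = 5" "\<forall>X\<in>set Xs. X \<noteq> {} \<and> connected_in E X"
    and srt: "sorted_wrt (\<lambda>X Y. X \<inter> Y = {} \<and> (\<exists>x\<in>X. \<exists>y\<in>Y. (x, y) \<in> E)) Xs"
  shows "K5_minor E"
  unfolding K5_minor_def
proof (intro exI conjI allI impI)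
  show "Xs ! i \<noteq> {}" "connected_in E (Xs ! i)" if "i < 5" for i using assms(2,3) that by auto
  have lt: "Xs ! i \<inter> Xs ! j = {} \<and> (\<exists>x\<in>Xs ! i. \<exists>y\<in>Xs ! j. (x, y) \<in> E)" if "i < j" "j < 5" for i j
    using sorted_wrt_nth_less[OF srt] that assms(2) by auto
  show "Xs ! i \<inter> Xs ! j = {}" if "i < 5" "j < 5" "i \<noteq> j" for i j
    using lt[of i j] lt[of j i] that by (cases "i < j") auto
  show "\<exists>x\<in>Xs ! i. \<exists>y\<in>Xs ! j. (x, y) \<in> E" if ij: "i < 5" "j < 5" "i \<noteq> j" for i j
  proof (cases "i < j")
    case True
    then show ?thesis using lt ij by blast
  next
    case False
    then obtain x y where "x \<in> Xs ! j" "y \<in> Xs ! i" "(x, y) \<in> E" using lt[of j i] ij by auto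
    then show ?thesis using assms(1) by (meson symD)
  qed
qed

lemma card_eq_sum_degrees:
  assumes "finite V" "E \<subseteq> V \<times> V"
  shows "card E = (\<Sum>v\<in>V. card (E `` {v}))"
proof -
  have "E = (SIGMA v:V. E `` {v})" using assms(2) by auto
  moreover have "finite (E `` {v})" for v using assms by (meson Image_singleton finite_subset finite_SigmaI finite_Image)
  ultimately show ?thesis using card_SigmaI[OF assms(1), of "\<lambda>v. E `` {v}"] by (metis (no_types, lifting))
qed

text \<open>A K4 within \<open>N\<close> forms a K5 with \<open>v\<close>. Each vertex of
  \<open>N\<close> misses at most \<open>card N - 4\<close> others, so the missing pairs form a
  matching. If there is at most one such pair, \<open>N\<close> contains a K4. If both
  \<open>a\<close>, \<open>b\<close> and \<open>x\<close>, \<open>y\<close> are missing pairs,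
  contracting the edge from \<open>a\<close> to \<open>x\<close> leaves a K4 together with
  \<open>b\<close>, \<open>y\<close> and the fifth vertex \<open>z\<close>.\<close>

lemma K5_minor_of_near_complete_nbhd:
  assumes E: "sym E" "irrefl E" and N: "card N \<in> {4, 5}" "N \<subseteq> E `` {v}"
    and deg: "\<And>u. u \<in> N \<Longrightarrow> card (N \<inter> E `` {u}) \<ge> 3"
  shows "K5_minor E"
proof -
  have fin: "finite N" using N(1) by (metis card.infinite insertE singletonD zero_neq_numeral)
  have v: "(v, x) \<in> E" "(x, v) \<in> E" "v \<noteq> x" "x \<noteq> v" if "x \<in> N" for x
    using that N(2) E by (auto dest: symD simp: irrefl_def)
  have sm: "(y, x) \<in> E" if "(x, y) \<in> E" for x y using that E(1) by (auto dest: symD)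
  have four: "K5_minor E" if d: "distinct [a, b, x, y]" "{a, b, x, y} \<subseteq> N"
    "(a, b) \<in> E" "(a, x) \<in> E" "(a, y) \<in> E" "(b, x) \<in> E" "(b, y) \<in> E" "(x, y) \<in> E" for a b x y
    by (rule K5_minor_list[of E "[{v}, {a}, {b}, {x}, {y}]"]) (use d v E in \<open>auto simp: connected_in_single\<close>)
  have nb: "N - insert u {w} \<subseteq> E `` {u}" if u: "u \<in> N" "w \<in> N" "u \<noteq> w" "(u, w) \<notin> E \<or> card N = 4" for u w
  proof -
    have sub: "N \<inter> E `` {u} \<subseteq> N - {u}" using E(2) by (auto simp: irrefl_def)
    have c: "card (N - {u}) = card N - 1" using fin u by simp
    show ?thesis
    proof (cases "card N = 4")
      case True
      then have "N \<inter> E `` {u} = N - {u}" using sub deg[OF u(1)] c fin by (intro card_seteq) auto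
      then show ?thesis by blast
    next
      case False
      then have "(u, w) \<notin> E" "card N = 5" using u N(1) by auto
      then have "N \<inter> E `` {u} \<subseteq> N - {u, w}" using sub by auto
      moreover have "card (N - {u, w}) = 3" using fin u \<open>card N = 5\<close> by (simp add: card_Diff_subset)
      ultimately have "N \<inter> E `` {u} = N - {u, w}" using deg[OF u(1)] fin by (intro card_seteq) auto
      then show ?thesis by blast
    qed
  qed
  show ?thesis
  proof (cases "\<forall>x\<in>N. \<forall>y\<in>N. x \<noteq> y \<longrightarrow> (x, y) \<in> E")
    case True
    have "4 \<le> card N" using N(1) by auto
    then obtain T where "T \<subseteq> N" "card T = 4" by (meson obtain_subset_with_card_n)
    moreover obtain a b x y where "T = {a, b, x, y}" "distinct [a, b, x, y]"
      using \<open>card T = 4\<close> by (auto simp: numeral_eq_Suc card_Suc_eq)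
    ultimately show ?thesis using True by (intro four[of a b x y]) auto
  next
    case False
    then obtain a b where ab: "a \<in> N" "b \<in> N" "a \<noteq> b" "(a, b) \<notin> E" by auto
    have "card N \<noteq> 4"
    proof
      assume c4: "card N = 4"
      have "card (N - {a, b}) = 2" using c4 ab fin by (simp add: card_Diff_subset)
      then have "N - {a, b} \<noteq> {}" by (metis card.empty zero_neq_numeral)
      then obtain w where w: "w \<in> N - {a, b}" by blast
      then have "b \<in> N - {a, w}" using ab by auto
      then show False using nb[of a w] ab w c4 by auto
    qed
    then have c5: "card N = 5" using N(1) by auto
    then have c3: "card (N - {a, b}) = 3" using ab fin by (simp add: card_Diff_subset)
    have aN: "(a, t) \<in> E" "(b, t) \<in> E" if "t \<in> N - {a, b}" for t
      using nb[of a b] nb[of b a] ab sm that by auto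
    show ?thesis
    proof (cases "\<forall>x\<in>N - {a, b}. \<forall>y\<in>N - {a, b}. x \<noteq> y \<longrightarrow> (x, y) \<in> E")
      case True
      obtain x y z where "N - {a, b} = {x, y, z}" "distinct [x, y, z]"
        using c3 by (auto simp: numeral_eq_Suc card_Suc_eq)
      moreover from this have "x \<in> N - {a, b}" "y \<in> N - {a, b}" "z \<in> N - {a, b}" by auto
      ultimately show ?thesis using True aN ab by (intro four[of a x y z]) auto
    next
      case False
      then obtain x y where xy: "x \<in> N - {a, b}" "y \<in> N - {a, b}" "x \<noteq> y" "(x, y) \<notin> E" by auto
      have "card (N - {a, b} - {x, y}) = 1" using c3 xy fin by (simp add: card_Diff_subset)
      then obtain z where z: "N - {a, b} - {x, y} = {z}" by (auto simp: card_1_singleton_iff)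
      then have z': "z \<in> N - {a, b}" "z \<noteq> x" "z \<noteq> y" by auto
      have "(x, z) \<in> E" "(y, z) \<in> E"
        using nb[of x y] nb[of y x] xy z' sm by auto
      then show ?thesis
        using xy z' ab aN[of x] aN[of y] aN[of z] v sm E
        by (intro K5_minor_list[of E "[{v}, {b}, {y}, {z}, {a, x}]"])
           (auto simp: connected_in_single connected_in_pair)
    qed
  qed
qed

text \<open>Mader's bound. In a minimal counterexample every edge lies in three triangles, and a vertex of
  degree at most five then has an almost complete neighbourhood.\<close>

lemma K5_minor_of_many_edges:
  assumes "finite V" "E \<subseteq> V \<times> V" "sym E" "irrefl E" "card V \<ge> 3" "card E + 10 \<ge> 6 * card V"
  shows "K5_minor E"
  using assms
proof (induction "card V + card E" arbitrary: V E rule: less_induct)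
  case less
  note V = less.prems
  have finE: "finite E" using V(1,2) finite_subset by blast
  have sm: "(y, x) \<in> E" if "(x, y) \<in> E" for x y using that V(3) by (auto dest: symD)
  have ir: "x \<noteq> y" if "(x, y) \<in> E" for x y using that V(4) by (auto simp: irrefl_def)
  have nV: "E `` {v} \<subseteq> V - {v}" for v using V(2) ir by auto
  have finN: "finite (E `` {v})" for v using finE by (rule finite_Image)
  have hs: "card E = (\<Sum>v\<in>V. card (E `` {v}))" by (rule card_eq_sum_degrees[OF V(1,2)])
  \<comment> \<open>Three vertices span at most 6 arcs, whereas the hypothesis would demand
    8.\<close>
  have n4: "card V \<ge> 4"
  proof (rule ccontr)
    assume "\<not> card V \<ge> 4"
    then have c: "card V = 3" using V(5) by simp
    have "card (E `` {v}) \<le> 2" if "v \<in> V" for v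
      using card_mono[OF _ nV[of v]] V(1) that c by simp
    then have "card E \<le> (\<Sum>v\<in>V. 2)" unfolding hs by (rule sum_mono)
    then show False using c V(6) by simp
  qed
  have del: "K5_minor E" if v: "v \<in> V" "E `` {v} = {}" for v
  proof (rule less.hyps[of "V - {v}" E])
    show "E \<subseteq> (V - {v}) \<times> (V - {v})" using V(2) v sm by auto
  qed (use V n4 v finE in auto)
  show ?case
  \<comment> \<open>With 8 in place of 10 there is an edge to spare: deleting its two arcs preserves
    the hypothesis.\<close>
  proof (cases "card E + 8 \<ge> 6 * card V")
    case True
    then have "card E > 0" using n4 by simp
    then obtain x y where xy: "(x, y) \<in> E" by (metis card_gt_0_iff ex_in_conv surj_pair)
    define F where "F = E - {(x, y), (y, x)}"
    have "card F = card E - 2" unfolding F_def using xy sm ir[OF xy] finE by (simp add: card_Diff_subset)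
    moreover have "card E \<ge> 2" using True n4 by simp
    moreover have "sym F" using V(3) by (auto simp: F_def sym_def)
    moreover have "irrefl F" "F \<subseteq> V \<times> V" using V(2,4) by (auto simp: F_def irrefl_def)
    ultimately have "K5_minor F" using V True by (intro less.hyps[of V F]) auto
    then show ?thesis by (rule K5_minor_mono) (auto simp: F_def)
  next
    case False
    \<comment> \<open>Contracting \<open>u\<close> onto \<open>v\<close> loses the edge between them
      and one edge for every common neighbour. With at most two common neighbours these are at most
      three edges, that is 6 arcs, exactly what the bound drops by for one vertex less.
      \<open>D\<close> collects the neighbours that \<open>v\<close> gains.\<close>
    have tri: "card (E `` {u} \<inter> E `` {v}) \<ge> 3" if uv: "(u, v) \<in> E" and no: "\<not> K5_minor E" for u v
    proof (rule ccontr)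
      assume few: "\<not> card (E `` {u} \<inter> E `` {v}) \<ge> 3"
      define D where "D = E `` {u} - {v} - E `` {v}"
      define R where "R = {(x, y) \<in> E. x \<noteq> u \<and> y \<noteq> u}"
      define F where "F = R \<union> {v} \<times> D \<union> D \<times> {v}"
      have uD: "u \<notin> D" "v \<notin> D" "u \<noteq> v" using ir uv by (auto simp: D_def)
      have finD: "finite D" using finN by (auto simp: D_def)
      have finO: "finite R" using finE by (auto simp: R_def intro: finite_subset)
      have cF: "card F = card R + card D + card D"
      proof -
        have "R \<inter> {v} \<times> D = {}" "(R \<union> {v} \<times> D) \<inter> D \<times> {v} = {}"
          using uD sm by (auto simp: R_def D_def)
        then show ?thesis unfolding F_def using finD finO by (simp add: card_Un_disjoint card_cartesian_product)
      qed
      have cE: "card E = card R + card (E `` {u}) + card (E `` {u})"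
      proof -
        define A where "A = E `` {u}"
        have eq: "E = R \<union> {u} \<times> A \<union> A \<times> {u}" using sm by (auto simp: R_def A_def)
        have "R \<inter> {u} \<times> A = {}" "(R \<union> {u} \<times> A) \<inter> A \<times> {u} = {}"
          using ir by (auto simp: R_def A_def)
        moreover have "finite A" using finN by (simp add: A_def)
        ultimately have "card (R \<union> {u} \<times> A \<union> A \<times> {u}) = card R + card A + card A"
          using finO by (simp add: card_Un_disjoint card_cartesian_product)
        then show ?thesis unfolding A_def[symmetric] using arg_cong[OF eq, of card] by (rule trans[rotated])
      qed
      have cN: "card (E `` {u}) \<le> Suc (card D + card (E `` {u} \<inter> E `` {v}))"
      proof -
        have "E `` {u} = insert v (D \<union> (E `` {u} \<inter> E `` {v}))" using uv by (auto simp: D_def)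
        moreover have "finite (D \<union> (E `` {u} \<inter> E `` {v}))" using finD finN by blast
        ultimately have "card (E `` {u}) \<le> Suc (card (D \<union> (E `` {u} \<inter> E `` {v})))"
          by (metis card_insert_if le_SucI order_refl)
        also have "card (D \<union> (E `` {u} \<inter> E `` {v})) \<le> card D + card (E `` {u} \<inter> E `` {v})" by (rule card_Un_le)
        finally show ?thesis by simp
      qed
      have "K5_minor F"
      proof (rule less.hyps[of "V - {u}" F])
        have uV: "u \<in> V" "v \<in> V" using uv V(2) by auto
        show "card (V - {u}) + card F < card V + card E"
        proof -
          have "card D \<le> card (E `` {u})" using finN by (intro card_mono) (auto simp: D_def)
          moreover have "card (V - {u}) < card V" using uV V(1) by (intro card_Diff1_less)
          ultimately show ?thesis using cF cE by linarith
        qed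
        show "F \<subseteq> (V - {u}) \<times> (V - {u})" using V(2) uV uD by (auto simp: F_def R_def D_def)
        show "sym F" using V(3) by (auto simp: F_def R_def sym_def)
        show "irrefl F" using V(4) uD by (auto simp: F_def R_def irrefl_def)
        show "3 \<le> card (V - {u})" using n4 uV by simp
        show "6 * card (V - {u}) \<le> card F + 10"
          using cF cE cN few V(6) uV V(1) by (simp add: card_Diff_singleton)
      qed (use V in auto)
      then have "K5_minor E"
      proof (rule K5_minor_of_branch_sets[where B = "\<lambda>w. if w = u then {} else if w = v then {v, u} else {w}"])
        fix x y assume "(x, y) \<in> F"
        then show "\<exists>x'\<in>if x = u then {} else if x = v then {v, u} else {x}.
             \<exists>y'\<in>if y = u then {} else if y = v then {v, u} else {y}. (x', y') \<in> E"
          using uD sm by (auto simp: F_def R_def D_def)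
      qed (use uD connected_in_pair[OF sm[OF uv] V(3)] in \<open>auto simp: connected_in_single connected_in_def\<close>)
      then show False using no by simp
    qed
    have "\<exists>v\<in>V. card (E `` {v}) \<le> 5"
    proof (rule ccontr)
      assume "\<not> ?thesis"
      then have "\<And>v. v \<in> V \<Longrightarrow> 6 \<le> card (E `` {v})" by force
      then have "(\<Sum>v\<in>V. 6) \<le> card E" unfolding hs by (rule sum_mono)
      then show False using False by simp
    qed
    then obtain v where v: "v \<in> V" "card (E `` {v}) \<le> 5" by auto
    show ?thesis
    proof (rule ccontr)
      assume no: "\<not> K5_minor E"
      then obtain u where u: "(v, u) \<in> E" using del[OF v(1)] by auto
      have sub: "E `` {v} \<inter> E `` {w} \<subseteq> E `` {v} - {w}" for w using ir by auto
      \<comment> \<open>Three common neighbours of \<open>u\<close> and \<open>v\<close>, and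
        \<open>u\<close> itself, are four neighbours of \<open>v\<close>.\<close>
      have "card (E `` {v} - {u}) \<ge> 3"
        using tri[OF u no] card_mono[OF _ sub[of u]] finN by (meson finite_Diff le_trans)
      then have "card (E `` {v}) \<in> {4, 5}" using v(2) u finN[of v] by auto
      moreover have "card (E `` {v} \<inter> E `` {w}) \<ge> 3" if "w \<in> E `` {v}" for w
        using tri[of v w] that no by auto
      ultimately show False using K5_minor_of_near_complete_nbhd[OF V(3,4)] no by blast
    qed
  qed
qed

text \<open>\<open>E\<close> holds both arcs of each edge, so the factor 6 means three edges per
  vertex. Mader's bound starts at three vertices; below that, a crude degree count is
  enough.\<close>

lemma K5_minor_free_bound:
  assumes "finite V" "V \<noteq> {}" "E \<subseteq> V \<times> V" "sym E" "irrefl E" "\<not> K5_minor E"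
  shows "card E < 6 * card V"
proof (cases "card V \<ge> 3")
  case True
  then show ?thesis using K5_minor_of_many_edges[OF assms(1,3,4,5)] assms(6) by linarith
next
  case False
  have "card (E `` {v}) \<le> 2" for v
  proof -
    have "E `` {v} \<subseteq> V" using assms(3) by blast
    then have "card (E `` {v}) \<le> card V" by (rule card_mono[OF assms(1)])
    then show ?thesis using False by linarith
  qed
  then have "card E \<le> (\<Sum>v\<in>V. 2)" unfolding card_eq_sum_degrees[OF assms(1,3)] by (intro sum_mono)
  moreover have "card V > 0" using assms by (simp add: card_gt_0_iff)
  ultimately show ?thesis by simp
qed

section \<open>Discharging\<close>

lemma connected_in_star:
  assumes "sym E" "\<And>t. t \<in> T \<Longrightarrow> (t, w) \<in> E"
  shows "connected_in E (insert w T)"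
proof -
  let ?R = "(E \<inter> insert w T \<times> insert w T)\<^sup>*"
  have "(w, x) \<in> ?R \<and> (x, w) \<in> ?R" if "x \<in> insert w T" for x
  proof (cases "x = w")
    case False
    then have "(x, w) \<in> E" "(w, x) \<in> E" using assms that by (auto dest: symD)
    then show ?thesis using that by auto
  qed auto
  then show ?thesis unfolding connected_in_def by (meson rtrancl_trans)
qed

text \<open>Serves both contractions of the discharging argument. Merging \<open>t\<close> into
  \<open>ctr t\<close> makes \<open>ctr t\<close> adjacent to all of \<open>L t\<close>;
  \<open>R\<close> is the set of old arcs that are counted along with the new ones, possibly
  none.\<close>

lemma star_contraction_bound:
  assumes fin: "finite W" "finite T" and E: "sym E" "irrefl E" "\<not> K5_minor E"
    and R: "R \<subseteq> E \<inter> W \<times> W" "sym R" and T: "T \<inter> W = {}"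
    and ctr: "\<And>t. t \<in> T \<Longrightarrow> ctr t \<in> W \<and> (t, ctr t) \<in> E"
    and L: "\<And>t y. t \<in> T \<Longrightarrow> y \<in> L t \<Longrightarrow> y \<in> W \<and> (t, y) \<in> E \<and> y \<noteq> ctr t \<and> (ctr t, y) \<notin> R"
    and no4: "\<And>a b c d. (a, b) \<in> E \<Longrightarrow> (b, c) \<in> E \<Longrightarrow> (c, d) \<in> E \<Longrightarrow> (d, a) \<in> E \<Longrightarrow> a \<noteq> c \<Longrightarrow> b = d"
    and W: "W \<noteq> {}"
  shows "card R + (\<Sum>t\<in>T. 2 * card (L t)) < 6 * card W"
proof -
  define A where "A t = {ctr t} \<times> L t \<union> L t \<times> {ctr t}" for t
  define H where "H = R \<union> (\<Union>t\<in>T. A t)"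
  have sm: "(y, x) \<in> E" if "(x, y) \<in> E" for x y using that E(1) by (auto dest: symD)
  have finL: "finite (L t)" if "t \<in> T" for t
    using L[OF that] fin(1) by (meson finite_subset subsetI)
  have finA: "finite (A t)" if "t \<in> T" for t using finL[OF that] by (simp add: A_def)
  have finR: "finite R" by (rule finite_subset[OF _ finite_cartesian_product[OF fin(1,1)]]) (use R(1) in auto)
  have cA: "card (A t) = 2 * card (L t)" if "t \<in> T" for t
  proof -
    have "{ctr t} \<times> L t \<inter> L t \<times> {ctr t} = {}" using L[OF that] by auto
    then show ?thesis using finL[OF that] by (simp add: A_def card_Un_disjoint card_cartesian_product)
  qed
  have AE: "(t, x) \<in> E \<and> (t, y) \<in> E \<and> x \<noteq> y" if "t \<in> T" "(x, y) \<in> A t" for t x y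
    using that ctr[OF that(1)] L[OF that(1)] by (auto simp: A_def)
  \<comment> \<open>A pair \<open>x\<close>, \<open>y\<close> created by both \<open>t\<close> and
    \<open>t'\<close> would close the 4-cycle \<open>x\<close>, \<open>t\<close>, \<open>y\<close>,
    \<open>t'\<close>.\<close>
  have dA: "A t \<inter> A t' = {}" if t: "t \<in> T" "t' \<in> T" "t \<noteq> t'" for t t'
  proof (rule ccontr)
    assume "A t \<inter> A t' \<noteq> {}"
    then obtain x y where "(x, y) \<in> A t" "(x, y) \<in> A t'" by auto
    then have "(x, t) \<in> E" "(t, y) \<in> E" "(y, t') \<in> E" "(t', x) \<in> E" "x \<noteq> y"
      using AE t sm by blast+
    then show False using no4 t(3) by blast
  qed
  have AR: "R \<inter> (\<Union>t\<in>T. A t) = {}"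
  proof -
    have "(x, y) \<notin> A t" if "t \<in> T" "(x, y) \<in> R" for x y t
      using L[OF that(1)] that(2) R(2) by (auto simp: A_def dest: symD)
    then show ?thesis by auto
  qed
  have "card H = card R + card (\<Union>t\<in>T. A t)"
    unfolding H_def using finR finA fin(2) AR by (intro card_Un_disjoint) auto
  also have "card (\<Union>t\<in>T. A t) = (\<Sum>t\<in>T. card (A t))"
    using fin(2) finA dA by (intro card_UN_disjoint) auto
  also have "\<dots> = (\<Sum>t\<in>T. 2 * card (L t))" using cA by (intro sum.cong) auto
  finally have cH: "card H = card R + (\<Sum>t\<in>T. 2 * card (L t))" .
  have "\<not> K5_minor H"
  proof
    assume "K5_minor H"
    then have "K5_minor E"
    proof (rule K5_minor_of_branch_sets[where B = "\<lambda>w. if w \<in> W then insert w {t \<in> T. ctr t = w} else {}"])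
      fix w show "connected_in E (if w \<in> W then insert w {t \<in> T. ctr t = w} else {})"
      proof (cases "w \<in> W")
        case True
        have "connected_in E (insert w {t \<in> T. ctr t = w})"
          using ctr by (intro connected_in_star[OF E(1)]) auto
        then show ?thesis using True by simp
      qed (simp add: connected_in_def)
    next
      fix x y assume xy: "(x, y) \<in> H"
      show "\<exists>x'\<in>if x \<in> W then insert x {t \<in> T. ctr t = x} else {}.
              \<exists>y'\<in>if y \<in> W then insert y {t \<in> T. ctr t = y} else {}. (x', y') \<in> E"
      proof (cases "(x, y) \<in> R")
        case True
        then have "x \<in> W" "y \<in> W" "(x, y) \<in> E" using R(1) by auto
        then show ?thesis by auto
      next
        case False
        then obtain t where t: "t \<in> T" "(x, y) \<in> A t" using xy by (auto simp: H_def)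
        then have "x \<in> W" "y \<in> W" using ctr[OF t(1)] L[OF t(1)] by (auto simp: A_def)
        moreover have "(t, x) \<in> E" "(t, y) \<in> E" "ctr t = x \<or> ctr t = y" using AE[OF t] t(2) by (auto simp: A_def)
        ultimately show ?thesis using t(1) sm by auto
      qed
    qed (use T in auto)
    then show False using E(3) by simp
  qed
  moreover have "sym H"
    using R(2) by (auto simp: H_def A_def sym_def)
  moreover have "irrefl H" using R(1) E(2) AE by (auto simp: H_def irrefl_def)
  moreover have "H \<subseteq> W \<times> W" using R(1) ctr L by (auto simp: H_def A_def)
  ultimately show ?thesis using K5_minor_free_bound[OF fin(1) W, of H] cH by simp
qed

text \<open>Contracting a vertex with \<open>k\<close> relevant neighbours creates at least \<open>k - 2\<close> new edges, and one if
  \<open>k = 2\<close> because its neighbours are then non-adjacent; each neighbour is credited the \<open>k\<close>-th part.\<close>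

definition share :: "nat \<Rightarrow> real" where
  "share k = (if k = 2 then 1 / 2 else (real k - 2) / real k)"

text \<open>Among the admissible values, the ratio of \<open>share k\<close> to \<open>k - 1\<close>
  is least at \<open>k = 17\<close>, where it equals 15/272; 1/20 is a round number just below. For
  \<open>k > 2\<close> the claim follows from \<open>(k - 3) * (17 - k) \<ge> 0\<close>, as
  \<open>20 * (k - 2) - k * (k - 1)\<close> exceeds that product by \<open>k + 11\<close>.\<close>

lemma share_linear:
  assumes "2 \<le> k" "k \<le> 17"
  shows "share k \<ge> (real k - 1) / 20"
proof (cases "k = 2")
  case False
  then have "3 \<le> real k" "real k \<le> 17" using assms by auto
  then have "(real k - 3) * (17 - real k) \<ge> 0" by simp
  then have "(real k - 1) * real k \<le> 20 * (real k - 2)" by (simp add: algebra_simps)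
  then show ?thesis using False \<open>3 \<le> real k\<close> by (simp add: share_def field_simps)
qed (simp add: share_def)

lemma share_ge_third: "2 \<le> k \<Longrightarrow> share k \<ge> 1 / 3"
  by (auto simp: share_def field_simps)

lemma share_ge_half: "4 \<le> k \<Longrightarrow> share k \<ge> 1 / 2"
  by (auto simp: share_def field_simps)

text \<open>\<open>r\<close> counts the neighbours that stay, \<open>k\<close> describes the
  contracted ones. One of the \<open>r\<close> is left out of the sum because the summand
  \<open>D\<close> has paid for it. Up to \<open>r = 4\<close> the linear estimate suffices: the
  second sum is at least 73, 56, 39, 22 for \<open>r\<close> at most 1 and equal to 2, 3, 4, and a
  twentieth of it covers what is missing from 3.\<close>

lemma charge_ge_3:
  fixes k :: "'b \<Rightarrow> nat" and r :: nat
  assumes fin: "finite T" and k: "\<And>t. t \<in> T \<Longrightarrow> 2 \<le> k t \<and> k t \<le> 17"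
    and big: "73 \<le> 17 * (r - 1) + (\<Sum>t\<in>T. k t - 1)"
  shows "3 \<le> real r / 2 + (\<Sum>t\<in>T. share (k t))"
proof -
  define U where "U = (\<Sum>t\<in>T. k t - 1)"
  have "real U / 20 = (\<Sum>t\<in>T. (real (k t) - 1) / 20)"
    unfolding U_def of_nat_sum sum_divide_distrib
  proof (rule sum.cong)
    fix t assume "t \<in> T"
    then have "1 \<le> k t" using k[of t] by simp
    then show "real (k t - 1) / 20 = (real (k t) - 1) / 20" by (simp add: of_nat_diff)
  qed simp
  also have "\<dots> \<le> (\<Sum>t\<in>T. share (k t))" using k by (intro sum_mono share_linear) auto
  finally have lin: "real U / 20 \<le> (\<Sum>t\<in>T. share (k t))" .
  have third: "real (card T) / 3 \<le> (\<Sum>t\<in>T. share (k t))"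
    using sum_mono[of T "\<lambda>_. 1 / 3" "\<lambda>t. share (k t)"] k share_ge_third by simp
  have big': "73 \<le> 17 * (r - 1) + U" using big by (simp add: U_def)
  consider "r \<le> 1" | "r = 2" | "r = 3" | "r = 4" | "r = 5" | "r \<ge> 6" by linarith
  then show ?thesis
  proof cases
    \<comment> \<open>Only 1/2 is missing, but a sum of at least 5 gives merely 1/4 by the linear
      estimate. Two contracted neighbours bring 1/3 each, and a single one must be large enough to
      bring 1/2 alone.\<close>
    case 5
    then have U5: "U \<ge> 5" using big' by simp
    have "(\<Sum>t\<in>T. share (k t)) \<ge> 1 / 2"
    proof (cases "card T \<ge> 2")
      case True
      then show ?thesis using third by simp
    next
      case False
      moreover have "T \<noteq> {}" using U5 by (auto simp: U_def)
      ultimately have "card T = 1" using fin by (metis One_nat_def Suc_1 card_0_eq less_Suc_eq not_le less_one)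
      then obtain t where t: "T = {t}" by (auto simp: card_1_singleton_iff)
      then have "k t \<ge> 4" using U5 by (simp add: U_def)
      then show ?thesis using t share_ge_half by simp
    qed
    then show ?thesis using 5 by simp
  next
    case 6
    have "0 \<le> (\<Sum>t\<in>T. share (k t))" using lin by linarith
    then show ?thesis using 6 by simp
  qed (use big' lin in simp_all)
qed

text \<open>The middle vertex \<open>w\<close> is not confined to \<open>S\<close>: distances are
  those of the whole graph, which is why vertices outside \<open>S\<close> have to be contracted
  rather than deleted.\<close>

definition square_nbrs :: "('a \<times> 'a) set \<Rightarrow> 'a set \<Rightarrow> 'a \<Rightarrow> 'a set" where
  "square_nbrs E S v = {u \<in> S. u \<noteq> v \<and> ((v, u) \<in> E \<or> (\<exists>w. (v, w) \<in> E \<and> (w, u) \<in> E))}"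

lemma few_square_nbrs:
  assumes V: "finite V" "E \<subseteq> V \<times> V" and E: "sym E" "irrefl E" "\<not> K5_minor E"
    and no4: "\<And>a b c d. (a, b) \<in> E \<Longrightarrow> (b, c) \<in> E \<Longrightarrow> (c, d) \<in> E \<Longrightarrow> (d, a) \<in> E \<Longrightarrow> a \<noteq> c \<Longrightarrow> b = d"
    and D: "\<And>v. v \<in> V \<Longrightarrow> card (E `` {v}) \<le> D"
    and S: "S \<subseteq> V" "S \<noteq> {}"
  shows "\<exists>v\<in>S. card (square_nbrs E S v) \<le> D + 72"
proof (rule ccontr)
  assume "\<not> ?thesis"
  then have many: "D + 73 \<le> card (square_nbrs E S v)" if "v \<in> S" for v using that by force
  have sm: "(y, x) \<in> E" if "(x, y) \<in> E" for x y using that E(1) by (auto dest: symD)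
  have ir: "x \<noteq> y" if "(x, y) \<in> E" for x y using that E(2) by (auto simp: irrefl_def)
  define NS where "NS w = E `` {w} \<inter> S" for w
  define d where "d w = card (NS w)" for w
  define B where "B = {w \<in> V. d w \<ge> 18}"
  define W where "W = S \<union> B"
  \<comment> \<open>Not every small vertex outside \<open>S\<close> is contracted. One with fewer
    than two neighbours in \<open>S\<close> links no pair, and one with exactly two adjacent
    neighbours links a pair that is already joined; neither would create a new edge.\<close>
  define T where "T = {t \<in> V - W. d t \<ge> 3 \<or> d t = 2 \<and> (\<forall>x\<in>NS t. \<forall>y\<in>NS t. (x, y) \<notin> E)}"
  define ctr where "ctr t = (SOME c. c \<in> NS t)" for t
  define L where "L t = {y \<in> NS t. y \<noteq> ctr t \<and> (ctr t, y) \<notin> E}" for t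
  define S2 where "S2 = {v \<in> S - B. card (E `` {v} \<inter> B) \<ge> 2}"
  define S1 where "S1 = S - B - S2"
  have WV: "W \<subseteq> V" using S by (auto simp: W_def B_def)
  have "finite S" using V(1) S(1) finite_subset by blast
  then have fin: "finite W" "finite T" "finite S" "finite B" "finite S1" "finite S2"
    using V(1) by (simp_all add: W_def T_def B_def S1_def S2_def)
  have finS: "finite (NS w)" for w using fin(3) by (simp add: NS_def)
  have finN: "finite (E `` {w})" for w using V finite_subset by (meson finite_Image finite_SigmaI)
  have NSs: "v \<in> NS w \<longleftrightarrow> v \<in> S \<and> (w, v) \<in> E" for v w by (auto simp: NS_def)
  have Tk: "2 \<le> d t \<and> d t \<le> 17" if "t \<in> T" for t using that by (auto simp: T_def B_def W_def)
  have ctr: "ctr t \<in> NS t" if "t \<in> T" for t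
  proof -
    have "NS t \<noteq> {}" using Tk[OF that] by (auto simp: d_def)
    then show ?thesis unfolding ctr_def by (rule some_in_eq[THEN iffD2])
  qed

  \<comment> \<open>Two leaves already adjacent to the centre would close a 4-cycle.\<close>
  have cL: "real (d t) * share (d t) \<le> real (card (L t))" if t: "t \<in> T" for t
  proof -
    let ?K = "{y \<in> NS t. y \<noteq> ctr t \<and> (ctr t, y) \<in> E}"
    have c: "ctr t \<in> NS t" using ctr[OF t] .
    have "y = y'" if "y \<in> ?K" "y' \<in> ?K" for y y'
      using no4[of "ctr t" y t y'] that c sm ir by (auto simp: NSs)
    then have cK: "card ?K \<le> 1" using finS by (simp add: card_le_Suc0_iff_eq)
    have "NS t = insert (ctr t) (L t \<union> ?K)" using c by (auto simp: L_def)
    moreover have "ctr t \<notin> L t \<union> ?K" "finite (L t \<union> ?K)" using finS by (auto simp: L_def)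
    ultimately have "d t = Suc (card (L t \<union> ?K))" unfolding d_def by (metis card_insert_disjoint)
    moreover have "L t \<inter> ?K = {}" by (auto simp: L_def)
    ultimately have dt: "d t = Suc (card (L t) + card ?K)" using finS by (simp add: card_Un_disjoint L_def)
    show ?thesis
    proof (cases "d t = 2")
      case True
      then have "?K = {}" using t c by (auto simp: T_def)
      then have "card (L t) = 1" using dt True by (simp only: card.empty)
      then show ?thesis using True by (simp add: share_def)
    next
      case False
      then have "d t \<noteq> 0" using Tk[OF t] by simp
      then show ?thesis using dt cK False by (simp add: share_def)
    qed
  qed
  have Wne: "W \<noteq> {}" using S by (auto simp: W_def)
  have "card (E \<inter> W \<times> W) + (\<Sum>t\<in>T. 2 * card (L t)) < 6 * card W"
  proof (rule star_contraction_bound[where E = E and ctr = ctr])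
    show "sym (E \<inter> W \<times> W)" using E(1) by (auto simp: sym_def)
    show "ctr t \<in> W \<and> (t, ctr t) \<in> E" if "t \<in> T" for t using ctr[OF that] by (auto simp: NSs W_def)
    show "y \<in> W \<and> (t, y) \<in> E \<and> y \<noteq> ctr t \<and> (ctr t, y) \<notin> E \<inter> W \<times> W" if "t \<in> T" "y \<in> L t" for t y
      using that by (auto simp: L_def NSs W_def)
    show "T \<inter> W = {}" by (auto simp: T_def)
  qed (use fin E no4 Wne in auto)
  then have "real (card (E \<inter> W \<times> W) + (\<Sum>t\<in>T. 2 * card (L t))) < real (6 * card W)" by (simp only: of_nat_less_iff)
  then have bound: "real (card (E \<inter> W \<times> W)) / 2 + (\<Sum>t\<in>T. real (card (L t))) < 3 * real (card W)"
    by (simp add: sum_distrib_left[symmetric])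

  have S2bound: "card S2 \<le> 3 * card B"
  proof (cases "B = {}")
    case True
    then show ?thesis by (simp add: S2_def)
  next
    case False
    have "\<exists>x y. x \<in> E `` {v} \<inter> B \<and> y \<in> E `` {v} \<inter> B \<and> x \<noteq> y" if "v \<in> S2" for v
    proof -
      have "\<not> card (E `` {v} \<inter> B) \<le> Suc 0" using that by (simp add: S2_def)
      then show ?thesis using fin(4) by (simp add: card_le_Suc0_iff_eq) blast
    qed
    then obtain x y where xy: "\<And>v. v \<in> S2 \<Longrightarrow> x v \<in> E `` {v} \<inter> B \<and> y v \<in> E `` {v} \<inter> B \<and> x v \<noteq> y v"
      by metis
    \<comment> \<open>With no old arcs and a single leaf \<open>y v\<close> for each
      \<open>v\<close>, the bound says that twice \<open>card S2\<close> is below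
      \<open>6 * card B\<close>.\<close>
    have "card ({} :: ('a \<times> 'a) set) + (\<Sum>v\<in>S2. 2 * card {y v}) < 6 * card B"
    proof (rule star_contraction_bound[where E = E and ctr = x])
      show "S2 \<inter> B = {}" by (auto simp: S2_def)
      show "x v \<in> B \<and> (v, x v) \<in> E" if "v \<in> S2" for v using xy[OF that] by auto
      show "z \<in> B \<and> (v, z) \<in> E \<and> z \<noteq> x v \<and> (x v, z) \<notin> {}" if "v \<in> S2" "z \<in> {y v}" for v z
        using xy[OF that(1)] that(2) by auto
    qed (use fin E no4 False in \<open>auto simp: sym_def\<close>)
    then show ?thesis by simp
  qed

  define h where "h v = (\<Sum>t | t \<in> T \<and> (v, t) \<in> E. share (d t))" for v
  have share0: "0 \<le> share (d t)" if "t \<in> T" for t using share_ge_third[of "d t"] Tk[OF that] by simp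
  have h0: "0 \<le> h v" for v unfolding h_def by (rule sum_nonneg) (use share0 in auto)
  \<comment> \<open>Double counting: each \<open>t\<close> in \<open>T\<close> credits
    \<open>share (d t)\<close> to each of its \<open>d t\<close> neighbours in \<open>S\<close>, in
    total no more than the new edges it creates.\<close>
  have "(\<Sum>v\<in>S. h v) = (\<Sum>t\<in>T. \<Sum>v | v \<in> S \<and> (v, t) \<in> E. share (d t))"
    unfolding h_def using fin by (intro sum.swap_restrict) auto
  also have "\<dots> = (\<Sum>t\<in>T. real (d t) * share (d t))"
  proof (rule sum.cong)
    fix t
    have "{v. v \<in> S \<and> (v, t) \<in> E} = NS t" using sm by (auto simp: NSs)
    then show "(\<Sum>v | v \<in> S \<and> (v, t) \<in> E. share (d t)) = real (d t) * share (d t)" by (simp add: d_def)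
  qed simp
  also have "\<dots> \<le> (\<Sum>t\<in>T. real (card (L t)))" by (rule sum_mono) (rule cL)
  finally have hL: "(\<Sum>v\<in>S. h v) \<le> (\<Sum>t\<in>T. real (card (L t)))" .
  have h1: "(\<Sum>v\<in>S1. h v) \<le> (\<Sum>v\<in>S. h v)"
    by (rule sum_mono2) (use fin h0 in \<open>auto simp: S1_def\<close>)
  define r where "r v = card (E `` {v} \<inter> W)" for v
  have "card (E \<inter> W \<times> W) = (\<Sum>v\<in>W. card ((E \<inter> W \<times> W) `` {v}))"
    using fin by (intro card_eq_sum_degrees) auto
  also have "\<dots> = (\<Sum>v\<in>W. r v)"
    unfolding r_def by (intro sum.cong arg_cong[of _ _ card]) auto
  finally have cEW: "card (E \<inter> W \<times> W) = (\<Sum>v\<in>W. r v)" .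
  have "real (card (E \<inter> W \<times> W)) / 2 = (\<Sum>v\<in>W. real (r v) / 2)"
    unfolding cEW by (simp add: sum_divide_distrib)
  then have total: "(\<Sum>v\<in>W. real (r v) / 2) + (\<Sum>v\<in>S1. h v) < 3 * real (card W)"
    using bound hL h1 by linarith

  have rB: "9 \<le> real (r v) / 2" if "v \<in> B" for v
  proof -
    have "d v \<le> r v" unfolding d_def r_def NS_def using finN by (intro card_mono) (auto simp: W_def)
    then show ?thesis using that by (simp add: B_def)
  qed
  have r2: "1 \<le> real (r v) / 2" if "v \<in> S2" for v
  proof -
    have "card (E `` {v} \<inter> B) \<le> r v" unfolding r_def using finN by (intro card_mono) (auto simp: W_def)
    then show ?thesis using that by (simp add: S2_def)
  qed
  have r1: "3 \<le> real (r v) / 2 + h v" if v1: "v \<in> S1" for v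
  proof -
    define Q where "Q = E `` {v} \<inter> W"
    define P where "P = {t. t \<in> T \<and> (v, t) \<in> E}"
    \<comment> \<open>What the neighbour \<open>w\<close> accounts for, including itself if it is in
      \<open>S\<close>. Removing \<open>v\<close> makes up for adding \<open>w\<close>, so this is
      at most \<open>d w\<close>.\<close>
    define Z where "Z w = (if w \<in> S then insert w (NS w - {v}) else NS w - {v})" for w
    have v: "v \<in> S" "v \<notin> B" "card (E `` {v} \<inter> B) \<le> 1" using v1 by (auto simp: S1_def S2_def)
    have finQ: "finite Q" "finite P" using fin by (auto simp: Q_def P_def)
    have cZ: "card (Z w) \<le> d w" and vN: "card (NS w - {v}) = d w - 1" if "(v, w) \<in> E" for w
    proof -
      have "v \<in> NS w" using v(1) sm that by (simp add: NSs)
      then have dw: "d w = Suc (card (NS w - {v}))" unfolding d_def using finS by (metis card.remove)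
      then show "card (NS w - {v}) = d w - 1" by simp
      show "card (Z w) \<le> d w" using dw finS by (simp add: Z_def card_insert_if)
    qed
    have "square_nbrs E S v \<subseteq> (\<Union>w\<in>Q. Z w) \<union> (\<Union>t\<in>P. NS t - {v})"
    proof
      fix u assume "u \<in> square_nbrs E S v"
      then have u: "u \<in> S" "u \<noteq> v" "(v, u) \<in> E \<or> (\<exists>w. (v, w) \<in> E \<and> (w, u) \<in> E)" by (auto simp: square_nbrs_def)
      show "u \<in> (\<Union>w\<in>Q. Z w) \<union> (\<Union>t\<in>P. NS t - {v})"
      proof (cases "(v, u) \<in> E")
        case True
        then show ?thesis using u by (auto simp: Q_def W_def Z_def)
      next
        case False
        then obtain w where w: "(v, w) \<in> E" "(w, u) \<in> E" using u(3) by blast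
        then have uv: "u \<in> NS w" "v \<in> NS w" using u(1) v(1) sm by (auto simp: NSs)
        show ?thesis
        proof (cases "w \<in> W")
          case True
          then show ?thesis using w uv u(2) by (auto simp: Q_def Z_def)
        next
          case wW: False
          \<comment> \<open>Both \<open>u\<close> and \<open>v\<close> are neighbours of
            \<open>w\<close> in \<open>S\<close>. Were \<open>w\<close> not contracted, they would
            be its only ones there and adjacent, against the case assumption.\<close>
          have "w \<in> T"
          proof (rule ccontr)
            assume nT: "w \<notin> T"
            have "w \<in> V" using w V(2) by auto
            moreover have two: "card {u, v} = 2" using u(2) by simp
            moreover have "card {u, v} \<le> d w" unfolding d_def using uv finS by (intro card_mono) auto
            ultimately have dw: "d w = 2" using nT wW by (auto simp: T_def)
            then have "NS w = {u, v}"
              using card_seteq[OF finS[of w], of "{u, v}"] uv two by (auto simp: d_def)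
            moreover have "(u, v) \<notin> E" "(v, v) \<notin> E" "(u, u) \<notin> E" using False sm[of u v] ir by auto
            ultimately have "(x, y) \<notin> E" if "x \<in> NS w" "y \<in> NS w" for x y
              using that False by auto
            then show False using nT dw wW \<open>w \<in> V\<close> by (simp add: T_def)
          qed
          then show ?thesis using w uv u(2) by (auto simp: P_def)
        qed
      qed
    qed
    then have "card (square_nbrs E S v) \<le> card ((\<Union>w\<in>Q. Z w) \<union> (\<Union>t\<in>P. NS t - {v}))"
      using finQ finS by (intro card_mono) (auto simp: Z_def)
    also have "\<dots> \<le> card (\<Union>w\<in>Q. Z w) + card (\<Union>t\<in>P. NS t - {v})" by (rule card_Un_le)
    also have "card (\<Union>w\<in>Q. Z w) \<le> (\<Sum>w\<in>Q. card (Z w))" using finQ(1) by (rule card_UN_le)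
    also have "(\<Sum>w\<in>Q. card (Z w)) \<le> (\<Sum>w\<in>Q. d w)" using cZ by (intro sum_mono) (auto simp: Q_def)
    also have "card (\<Union>t\<in>P. NS t - {v}) \<le> (\<Sum>t\<in>P. card (NS t - {v}))" using finQ(2) by (rule card_UN_le)
    also have "\<dots> = (\<Sum>t\<in>P. d t - 1)" using vN by (intro sum.cong) (auto simp: P_def)
    finally have "D + 73 \<le> (\<Sum>w\<in>Q. d w) + (\<Sum>t\<in>P. d t - 1)" using many[OF v(1)] by linarith
    \<comment> \<open>At most one \<open>w0\<close> in \<open>Q\<close> is big, and
      \<open>d w0\<close> is bounded by its degree; all others count at most 17. The resulting
      \<open>D\<close> cancels against the one in \<open>many\<close>.\<close>
    moreover have "(\<Sum>w\<in>Q. d w) \<le> D + 17 * (card Q - 1)"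
    proof (cases "Q = {}")
      case False
      have "\<exists>w0\<in>Q. \<forall>w\<in>Q - {w0}. w \<notin> B"
      proof (cases "E `` {v} \<inter> B = {}")
        case True
        then show ?thesis using False by (auto simp: Q_def)
      next
        case False
        then obtain w0 where w0: "w0 \<in> E `` {v} \<inter> B" by blast
        have uniq: "w = w0" if "w \<in> E `` {v} \<inter> B" for w
          using v(3) that w0 fin(4) by (simp add: card_le_Suc0_iff_eq)
        have "w0 \<in> Q" using w0 by (simp add: Q_def W_def)
        moreover have "w \<notin> B" if "w \<in> Q - {w0}" for w
          using uniq[of w] that by (auto simp: Q_def)
        ultimately show ?thesis by blast
      qed
      then obtain w0 where w0: "w0 \<in> Q" "\<And>w. w \<in> Q - {w0} \<Longrightarrow> w \<notin> B" by blast
      have "d w \<le> 17" if "w \<in> Q - {w0}" for w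
        using w0(2)[OF that] that WV by (auto simp: B_def Q_def)
      then have "(\<Sum>w\<in>Q - {w0}. d w) \<le> (\<Sum>w\<in>Q - {w0}. 17)" by (rule sum_mono)
      also have "\<dots> = 17 * (card Q - 1)" using w0(1) by simp
      finally have "(\<Sum>w\<in>Q - {w0}. d w) \<le> 17 * (card Q - 1)" .
      moreover have "d w0 \<le> D"
      proof -
        have "d w0 \<le> card (E `` {w0})" unfolding d_def NS_def using finN by (intro card_mono) auto
        then show ?thesis using D[of w0] w0(1) WV by (auto simp: Q_def)
      qed
      ultimately show ?thesis using sum.remove[OF finQ(1) w0(1), of d] by simp
    qed simp
    ultimately have "73 \<le> 17 * (card Q - 1) + (\<Sum>t\<in>P. d t - 1)" by linarith
    then have "3 \<le> real (card Q) / 2 + (\<Sum>t\<in>P. share (d t))"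
      using finQ(2) Tk by (intro charge_ge_3) (auto simp: P_def)
    then show ?thesis by (simp add: r_def h_def Q_def P_def)
  qed
  have part: "W = B \<union> (S2 \<union> S1)" "B \<inter> (S2 \<union> S1) = {}" "S2 \<inter> S1 = {}"
    by (auto simp: W_def S2_def S1_def)
  have "(\<Sum>v\<in>W. real (r v) / 2) = (\<Sum>v\<in>B. real (r v) / 2) + ((\<Sum>v\<in>S2. real (r v) / 2) + (\<Sum>v\<in>S1. real (r v) / 2))"
    unfolding part(1) using part(2,3) fin by (simp add: sum.union_disjoint)
  moreover have "real (card B) * 9 \<le> (\<Sum>v\<in>B. real (r v) / 2)" by (rule sum_bounded_below) (rule rB)
  moreover have "real (card S2) * 1 \<le> (\<Sum>v\<in>S2. real (r v) / 2)" by (rule sum_bounded_below) (rule r2)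
  moreover have "real (card S1) * 3 \<le> (\<Sum>v\<in>S1. real (r v) / 2 + h v)" by (rule sum_bounded_below) (rule r1)
  moreover have "card W = card B + (card S2 + card S1)"
    unfolding part(1) using part(2,3) fin by (simp add: card_Un_disjoint)
  ultimately show False using total S2bound by (simp add: sum.distrib)
qed

section \<open>The square of the graph\<close>

text \<open>The distance is an infimum over walks, and the number of arcs of a walk is an integer:
  if every walk had at least three arcs, the infimum would be at least 3. Hence a walk with at most
  two arcs exists.\<close>

lemma square_arcD:
  assumes G: "pair_graph G" and uv: "(u, v) \<in> parcs (square G)"
  shows "u \<in> pverts G" "v \<in> pverts G" "u \<noteq> v" "(u, v) \<in> parcs G \<or> (\<exists>w. (u, w) \<in> parcs G \<and> (w, v) \<in> parcs G)"
proof -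
  interpret pair_graph G by (rule G)
  show V: "u \<in> pverts G" "v \<in> pverts G" and ne: "u \<noteq> v" using uv by (auto simp: square_def)
  have "\<mu> (\<lambda>_. 1) u v \<le> 2" using uv by (simp add: square_def graph_dist_def)
  then have inf: "(INF p\<in>{p. awalk u p v}. ereal (awalk_cost (\<lambda>_. 1) p)) \<le> 2" by (simp add: \<mu>_def)
  have "\<exists>p. awalk u p v \<and> length p \<le> 2"
  proof (rule ccontr)
    assume no: "\<not> ?thesis"
    have "3 \<le> ereal (awalk_cost (\<lambda>_. 1) p)" if "awalk u p v" for p
    proof -
      have "awalk_cost (\<lambda>_. 1) p = real (length p)" by (induction p) simp_all
      moreover have "3 \<le> length p" using no that by force
      ultimately show ?thesis by simp
    qed
    then have "3 \<le> (INF p\<in>{p. awalk u p v}. ereal (awalk_cost (\<lambda>_. 1) p))" by (intro INF_greatest) simp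
    then have "(3 :: ereal) \<le> 2" using inf by (rule order_trans)
    then show False by simp
  qed
  then obtain p where p: "awalk u p v" "length p \<le> 2" by blast
  show "(u, v) \<in> parcs G \<or> (\<exists>w. (u, w) \<in> parcs G \<and> (w, v) \<in> parcs G)"
  proof (cases p)
    case Nil
    then show ?thesis using p(1) ne by (simp add: awalk_def)
  next
    case (Cons e q)
    then show ?thesis using p by (cases q) (auto simp: awalk_def)
  qed
qed

lemma degree_le_max_degree:
  assumes G: "pair_graph G" and v: "v \<in> pverts G"
  shows "card (parcs G `` {v}) \<le> max_degree G"
proof -
  interpret pair_graph G by (rule G)
  have "out_arcs (with_proj G) v = Pair v ` (parcs G `` {v})" by (auto simp: out_arcs_def)
  then have "out_degree (with_proj G) v = card (parcs G `` {v})"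
    by (simp add: out_degree_def card_image inj_on_def)
  moreover have "out_degree (with_proj G) v \<le> max_degree G"
    unfolding max_degree_def using pair_finite_verts v by (intro Max_ge) auto
  ultimately show ?thesis by simp
qed

lemma no_four_cycle:
  assumes G: "pair_graph G" and no: "\<not> (\<exists>C. pre_digraph.cycle (with_proj G) C \<and> length C = 4)"
    and e: "(a, b) \<in> parcs G" "(b, c) \<in> parcs G" "(c, d) \<in> parcs G" "(d, a) \<in> parcs G" and ac: "a \<noteq> c"
  shows "b = d"
proof (rule ccontr)
  interpret pair_graph G by (rule G)
  assume bd: "b \<noteq> d"
  have ne: "a \<noteq> b" "b \<noteq> c" "c \<noteq> d" "d \<noteq> a" using e pair_no_loops by fastforce+
  have "cycle [(a, b), (b, c), (c, d), (d, a)]"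
    unfolding cycle_def
    by (rule exI[of _ a]) (use e ne ac bd in_arcsD1 in \<open>auto simp: awalk_def\<close>)
  then show False using no by (auto simp: numeral_eq_Suc)
qed

lemma pair_graph_relation:
  assumes "pair_graph G"
  shows "finite (pverts G)" "parcs G \<subseteq> pverts G \<times> pverts G" "sym (parcs G)" "irrefl (parcs G)"
proof -
  interpret pair_graph G by (rule assms)
  show "finite (pverts G)" by (rule pair_finite_verts)
  show "parcs G \<subseteq> pverts G \<times> pverts G" using in_arcsD1 in_arcsD2 by auto
  show "sym (parcs G)" using pair_sym_arcs by (auto simp: symmetric_def)
  show "irrefl (parcs G)" using pair_no_loops by (force simp: irrefl_def)
qed

lemma square_nbrs_mono: "S \<subseteq> S' \<Longrightarrow> square_nbrs E S v \<subseteq> square_nbrs E S' v"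
  by (auto simp: square_nbrs_def)

text \<open>A vertex with few square neighbours in all of \<open>V\<close> is put last, and the rest
  is ordered by induction. Adjacency is never recomputed after a removal, because
  \<open>square_nbrs\<close> keeps \<open>E\<close> fixed and only shrinks the set.\<close>

lemma degeneracy_ordering:
  assumes "finite V"
    and "\<And>S. S \<subseteq> V \<Longrightarrow> S \<noteq> {} \<Longrightarrow> \<exists>v\<in>S. card (square_nbrs E S v) \<le> k"
  shows "\<exists>\<sigma>. distinct \<sigma> \<and> set \<sigma> = V \<and>
    (\<forall>i < length \<sigma>. card (square_nbrs E (set (take i \<sigma>)) (\<sigma> ! i)) \<le> k)"
  using assms
proof (induction V rule: finite_psubset_induct)
  case (psubset V)
  show ?case
  proof (cases "V = {}")
    case False
    then obtain v where v: "v \<in> V" "card (square_nbrs E V v) \<le> k" using psubset.prems by blast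
    have "\<exists>\<sigma>. distinct \<sigma> \<and> set \<sigma> = V - {v} \<and>
      (\<forall>i < length \<sigma>. card (square_nbrs E (set (take i \<sigma>)) (\<sigma> ! i)) \<le> k)"
      by (rule psubset.IH) (use v psubset.prems in auto)
    then obtain \<sigma> where \<sigma>: "distinct \<sigma>" "set \<sigma> = V - {v}"
      "\<And>i. i < length \<sigma> \<Longrightarrow> card (square_nbrs E (set (take i \<sigma>)) (\<sigma> ! i)) \<le> k" by blast
    have "finite (square_nbrs E V v)" using psubset.hyps by (simp add: square_nbrs_def)
    then have "card (square_nbrs E (V - {v}) v) \<le> k"
      using v(2) card_mono[OF _ square_nbrs_mono[of "V - {v}" V E v]] by (meson Diff_subset le_trans)
    then have "card (square_nbrs E (set (take i (\<sigma> @ [v]))) ((\<sigma> @ [v]) ! i)) \<le> k" if "i < length (\<sigma> @ [v])" for i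
      using \<sigma> that by (cases "i < length \<sigma>") (auto simp: nth_append less_Suc_eq)
    then show ?thesis using \<sigma> v by (intro exI[of _ "\<sigma> @ [v]"]) auto
  qed simp
qed

theorem theorem1:
  fixes G :: "'a pair_pre_digraph"
  assumes "pair_graph G"
    and "planar G"
    and "\<not> (\<exists>C. pre_digraph.cycle (with_proj G) C \<and> length C = 4)"
  shows "(\<exists>\<sigma>. distinct \<sigma> \<and> set \<sigma> = pverts G \<and>
           (\<forall>i < length \<sigma>.
              card {u \<in> set (take i \<sigma>). (u, \<sigma> ! i) \<in> parcs (square G)} \<le> max_degree G + 72))
         \<and> degenerate (max_degree G + 72) (square G)"
proof -
  note G = pair_graph_relation[OF assms(1)]
  let ?k = "max_degree G + 72"
  have key: "\<exists>v\<in>S. card (square_nbrs (parcs G) S v) \<le> ?k" if "S \<subseteq> pverts G" "S \<noteq> {}" for S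
    by (rule few_square_nbrs[OF G planar_no_K5_minor[OF assms(1,2)] no_four_cycle[OF assms(1,3)]
          degree_le_max_degree[OF assms(1)] that])
  have sm: "(y, x) \<in> parcs G" if "(x, y) \<in> parcs G" for x y using that G(3) by (auto dest: symD)
  \<comment> \<open>The ordering counts arcs of the square that end in the vertex, the out-degree
    counts those that start in it; hence the two versions.\<close>
  have sq: "u \<in> square_nbrs (parcs G) S v" if "(u, v) \<in> parcs (square G)" "u \<in> S" for u v S
    unfolding square_nbrs_def using square_arcD(3,4)[OF assms(1) that(1)] that(2) sm by blast
  have sq': "u \<in> square_nbrs (parcs G) S v" if "(v, u) \<in> parcs (square G)" "u \<in> S" for u v S
    using square_arcD[OF assms(1) that(1)] that(2) by (auto simp: square_nbrs_def)
  have fin: "finite (square_nbrs (parcs G) S v)" if "finite S" for S v using that by (simp add: square_nbrs_def)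
  obtain \<sigma> where \<sigma>: "distinct \<sigma>" "set \<sigma> = pverts G"
    "\<And>i. i < length \<sigma> \<Longrightarrow> card (square_nbrs (parcs G) (set (take i \<sigma>)) (\<sigma> ! i)) \<le> ?k"
    using degeneracy_ordering[OF G(1) key] by blast
  have "card {u \<in> set (take i \<sigma>). (u, \<sigma> ! i) \<in> parcs (square G)} \<le> ?k" if "i < length \<sigma>" for i
  proof -
    have "card {u \<in> set (take i \<sigma>). (u, \<sigma> ! i) \<in> parcs (square G)}
        \<le> card (square_nbrs (parcs G) (set (take i \<sigma>)) (\<sigma> ! i))"
      by (rule card_mono) (use fin sq in auto)
    then show ?thesis using \<sigma>(3)[OF that] by (rule order_trans)
  qed
  moreover have "degenerate ?k (square G)"
    unfolding degenerate_def
  proof (intro allI impI, elim conjE)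
    fix H :: "'a pair_pre_digraph"
    assume H: "pair_graph H" "subgraph (with_proj H) (with_proj (square G))" "pverts H \<noteq> {}"
    have sub: "pverts H \<subseteq> pverts G" "parcs H \<subseteq> parcs (square G)"
      using H(2) by (auto simp: subgraph_def square_def)
    \<comment> \<open>\<open>H\<close> need not be induced, but its arcs at \<open>v\<close> lead to
      square neighbours of \<open>v\<close> within \<open>pverts H\<close>, so their number is
      bounded as well.\<close>
    obtain v where v: "v \<in> pverts H" "card (square_nbrs (parcs G) (pverts H) v) \<le> ?k" using key[OF sub(1) H(3)] by blast
    have "out_arcs (with_proj H) v \<subseteq> Pair v ` square_nbrs (parcs G) (pverts H) v"
    proof
      fix e assume "e \<in> out_arcs (with_proj H) v"
      then obtain u where u: "e = (v, u)" "(v, u) \<in> parcs H" by (cases e) (auto simp: out_arcs_def)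
      then have "u \<in> pverts H" using pair_graph_relation(2)[OF H(1)] by auto
      then show "e \<in> Pair v ` square_nbrs (parcs G) (pverts H) v" using sq'[of v u] sub(2) u by auto
    qed
    then have "out_degree (with_proj H) v \<le> card (square_nbrs (parcs G) (pverts H) v)"
      unfolding out_degree_def
      using surj_card_le[of "square_nbrs (parcs G) (pverts H) v"] fin pair_graph_relation(1)[OF H(1)] by blast
    then show "\<exists>v\<in>pverts H. out_degree (with_proj H) v \<le> ?k" using v by (meson le_trans)
  qed
  ultimately show ?thesis using \<sigma>(1,2) by blast
qed

end
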